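(* Let $n\ge2$ and let $\Omega$ be a bounded $s$-John domain in $\mathbb{R}^n$ with $1\le s<n/(n-1)$, and let $\delta\in(0,n]$. If $u\in C^1(\Omega)$, then for every $t>0$ \[ \inf_{b\in\mathbb{R}}\mathcal{H}^{\delta}_\infty\big(\{x\in\Omega: |u(x)-b|>t\}\big)\le c\,t^{-\frac{\delta}{s(n-1)}}\Big(\int_\Omega|\nabla u(x)|^{\delta/n}\,d\mathcal{H}^{\delta}_\infty\Big)^{\frac{n}{s(n-1)}}, \] where $c$ is a constant depending only on $n,\delta,\Omega$.
   Context: Let $s\ge1$. A bounded domain (open connected set) $\Omega\subset\mathbb{R}^n$ is an $s$-John domain if there are finite positive constants $c_J,C_J$ and a point $x_0\in\Omega$ such that every $x\in\Omega$ can be joined to $x_0$ by a rectifiable curve $\gamma_x:[0,\ell(\gamma_x)]\to\Omega$ parametrised by arc length with $\gamma_x(0)=x$, $\gamma_x(\ell(\gamma_x))=x_0$, $\ell(\gamma_x)\le C_J$, and $\operatorname{dist}(\gamma_x(t),\partial\Omega)\ge c_J t^s$ for all $t\in[0,\ell(\gamma_x)]$. For $E\subset\mathbb{R}^n$ and $\beta\in(0,n]$, $\mathcal{H}^{\beta}_\infty(E)=\inf\{\sum_i r_i^{\beta}: E\subset\bigcup_i B(x_i,r_i)\}$ over countable or finite coverings by open balls. For $f:\Omega\to[0,\infty]$, $\int_\Omega f\,d\mathcal{H}^{\beta}_\infty:=\int_0^\infty \mathcal{H}^{\beta}_\infty(\{x\in\Omega: f(x)>t\})\,dt$. *)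

theory Defs
  imports "HOL-Analysis.Analysis"
begin

definition arc_length :: "(real \<Rightarrow> 'a::metric_space) \<Rightarrow> real \<Rightarrow> real \<Rightarrow> ennreal" where
  "arc_length \<gamma> a b =
     (SUP pk \<in> {(p, k). p 0 = a \<and> p k = b \<and> (\<forall>i<k. p i \<le> p (Suc i))}.
        ennreal (\<Sum>i<snd pk. dist (\<gamma> (fst pk i)) (\<gamma> (fst pk (Suc i)))))"

definition arclength_param :: "(real \<Rightarrow> 'a::metric_space) \<Rightarrow> real \<Rightarrow> bool" where
  "arclength_param \<gamma> l \<longleftrightarrow> 0 \<le> l \<and>
     (\<forall>a b. 0 \<le> a \<and> a \<le> b \<and> b \<le> l \<longrightarrow> arc_length \<gamma> a b = ennreal (b - a))"

definition s_john_domain :: "real \<Rightarrow> 'a::euclidean_space set \<Rightarrow> bool" where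
  "s_john_domain s \<Omega> \<longleftrightarrow> 1 \<le> s \<and> open \<Omega> \<and> connected \<Omega> \<and> bounded \<Omega> \<and> \<Omega> \<noteq> {} \<and>
     (\<exists>cJ CJ x0. 0 < cJ \<and> 0 < CJ \<and> x0 \<in> \<Omega> \<and>
        (\<forall>x\<in>\<Omega>. \<exists>\<gamma> l. arclength_param \<gamma> l \<and> \<gamma> 0 = x \<and> \<gamma> l = x0 \<and> l \<le> CJ \<and>
           (\<forall>t\<in>{0..l}. \<gamma> t \<in> \<Omega> \<and> infdist (\<gamma> t) (frontier \<Omega>) \<ge> cJ * t powr s)))"

text \<open>Hausdorff content of dimension beta: countable (finite = padded with radius 0) coverings by open balls.\<close>
definition hcontent :: "real \<Rightarrow> 'a::metric_space set \<Rightarrow> ennreal" where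
  "hcontent \<beta> E =
     (INF xr \<in> {(x, r). (\<forall>i::nat. 0 \<le> r i) \<and> E \<subseteq> (\<Union>i. ball (x i) (r i))}.
        (\<Sum>i. ennreal (snd xr i powr \<beta>)))"

definition choquet_hcontent :: "real \<Rightarrow> 'a::metric_space set \<Rightarrow> ('a \<Rightarrow> real) \<Rightarrow> ennreal" where
  "choquet_hcontent \<beta> \<Omega> f =
     (\<integral>\<^sup>+ t. indicator {0..} t * hcontent \<beta> {x \<in> \<Omega>. f x > t} \<partial>lborel)"

text \<open>Power of an extended nonnegative real with positive real exponent (\<infinity> stays \<infinity>).\<close>
definition enn_powr :: "ennreal \<Rightarrow> real \<Rightarrow> ennreal" where
  "enn_powr x p = (if x = \<infinity> then \<infinity> else ennreal (enn2real x powr p))"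

end

theory Submission
  imports Defs
begin

text \<open>
  Write \<open>n\<close> for the dimension, \<open>f = |Du|\<close> and \<open>K\<close> for the Choquet integral of \<open>f\<^sup>\<delta>\<^sup>/\<^sup>n\<close>.
  Covering the superlevel sets of \<open>f\<^sup>\<delta>\<^sup>/\<^sup>n\<close> at the heights \<open>2^q\<close> by dyadic cells gives weights
  \<open>b\<close> on the cells such that every value \<open>f x ^ (\<delta>/n)\<close> is dominated by the weight of some cell around
  \<open>x\<close>, and \<open>\<Sum> b(Q) side(Q)^\<delta>\<close> is comparable to \<open>K\<close>. Since \<open>\<delta> \<le> n\<close>, this bounds the integral of \<open>f\<close>
  over a cell by the weights above and below it, which yields \<open>\<integral> f \<le> C K^(n/\<delta>)\<close> and the weak type bound
  \<open>C \<theta>^(-\<delta>/n) K\<close> for the content of the set where the maximal function of \<open>f\<close> exceeds \<open>\<theta>\<close>.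

  On the other side, averages of \<open>u\<close> over cubes of size comparable to the distance to the boundary,
  followed along a John curve starting at \<open>x\<close>, bound \<open>|u x - b|\<close> by
  \<open>\<Sum>k. side_k^(1-n) \<integral> f\<close>, the \<open>k\<close>-th integral being over the ball around \<open>x\<close> of radius
  \<open>C side_k^(1/s)\<close>. Bounding these integrals by the total mass for large \<open>side_k\<close> and by the maximal
  function for small \<open>side_k\<close> (Hedberg's trick; \<open>s < n/(n-1)\<close> makes both geometric series converge) shows
  that \<open>|u x - b| > t\<close> forces the maximal function at \<open>x\<close> to be large.
\<close>

section \<open>Dyadic cells\<close>

text \<open>The Hausdorff content is not additive, so masses of disjoint sets cannot be summed in
  it. All additive bookkeeping is moved to the weights, which form a genuine measure on the dyadic
  tree; the content enters only when the weights are made and when a finished cover is priced by the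
  \<delta>-th powers of its sides. The exponent \<delta>/n fits because (b *
  side^\<delta>)^(n/\<delta>) = b^(n/\<delta>) * side^n is the Lebesgue mass of b^(n/\<delta>) on a
  cell, and for n/\<delta> >= 1 a sum of such powers is at most the power of the sum. With total
  mass M and maximal function at most \<theta>, the k-th term of the potential is, up to constants,
  at most side^(1-n) * min M (\<theta> * side^(n/s)). The minimum balances at side^(n/s) =
  M/\<theta>, giving M^(1-\<beta>) * \<theta>^\<beta> with \<beta> = s(n-1)/n < 1. Solving for
  \<theta> and inserting M = K^(n/\<delta>) into the weak type bound yields both exponents of the
  theorem. A positive \<epsilon> added to K pays for near-optimal covers and keeps all quantities
  positive; it tends to 0 at the end.\<close>

lemma nn_integral_count_space_image_le:
  fixes h :: "'b \<Rightarrow> ennreal"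
  shows "(\<integral>\<^sup>+ y. h y \<partial>count_space (\<phi> ` A)) \<le> (\<integral>\<^sup>+ x. h (\<phi> x) \<partial>count_space A)"
proof -
  obtain A' where A': "A' \<subseteq> A" "inj_on \<phi> A'" "\<phi> ` A' = \<phi> ` A"
    using subset_image_inj[of "\<phi> ` A" \<phi> A] by auto
  have "(\<integral>\<^sup>+ y. h y \<partial>count_space (\<phi> ` A)) = (\<integral>\<^sup>+ x. h (\<phi> x) \<partial>count_space A')"
    using nn_integral_bij_count_space[of \<phi> A' "\<phi> ` A" h] A' by (auto simp: bij_betw_def)
  also have "\<dots> \<le> (\<integral>\<^sup>+ x. h (\<phi> x) \<partial>count_space A)"
    using A'(1) by (simp add: nn_integral_count_space_indicator[of A] nn_integral_count_space_indicator[of A'])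
      (intro nn_integral_mono, auto split: split_indicator)
  finally show ?thesis .
qed

definition side :: "real \<Rightarrow> nat \<Rightarrow> real" where
  "side L k = L / 2 ^ k"

text \<open>The integer vector labelling the half-open cell of side \<open>side L k\<close> that
  contains x. A cell is handled as the pair (k, m), its points being the fibre of
  \<open>idx L k\<close> over m, so membership and measurability are read off from floors.\<close>

definition idx :: "real \<Rightarrow> nat \<Rightarrow> 'a::euclidean_space \<Rightarrow> 'a" where
  "idx L k x = (\<Sum>i\<in>Basis. of_int \<lfloor>x \<bullet> i / side L k\<rfloor> *\<^sub>R i)"

definition cells :: "real \<Rightarrow> (nat \<times> 'a::euclidean_space) set" where
  "cells L = (SIGMA k:UNIV. range (idx L k))"

text \<open>The offsets from a cell to the 3^n cells touching it, itself included. Both the cover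
  constants and the overlap constants below are multiples of \<open>card nbrs\<close>.\<close>

definition nbrs :: "'a::euclidean_space set" where
  "nbrs = (\<lambda>c. \<Sum>i\<in>Basis. c i *\<^sub>R i) ` (Basis \<rightarrow>\<^sub>E {-1, 0, 1})"

lemma side_pos: "L > 0 \<Longrightarrow> side L k > 0"
  by (simp add: side_def)

lemma side_Suc: "side L (Suc k) = side L k / 2"
  by (simp add: side_def)

lemma side_antimono: "L > 0 \<Longrightarrow> j \<le> k \<Longrightarrow> side L k \<le> side L j"
  by (auto simp: side_def intro!: divide_left_mono power_increasing)

lemma idx_inner: "i \<in> Basis \<Longrightarrow> idx L k x \<bullet> i = of_int \<lfloor>x \<bullet> i / side L k\<rfloor>"
  by (simp add: idx_def)

lemma idx_eq_iff:
  "idx L k x = idx L k y \<longleftrightarrow> (\<forall>i\<in>Basis. \<lfloor>x \<bullet> i / side L k\<rfloor> = \<lfloor>y \<bullet> i / side L k\<rfloor>)"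
  by (auto simp: euclidean_eq_iff[of "idx L k x"] idx_inner)

lemma floor_half_eq: "\<lfloor>(a::real)\<rfloor> = \<lfloor>(b::real)\<rfloor> \<Longrightarrow> \<lfloor>a / 2\<rfloor> = \<lfloor>b / 2\<rfloor>"
  using floor_divide_real_eq_div[of 2 a] floor_divide_real_eq_div[of 2 b] by simp

text \<open>Nestedness of the grids: the floor of a/2 depends only on the floor of a, so sharing a
  cell passes to every coarser generation. Branch sums and stopping cells rely on this.\<close>

lemma idx_eq_coarser:
  assumes "idx L k x = idx L k y" "j \<le> k"
  shows "idx L j x = idx L j y"
  using assms(2,1)
proof (induction rule: inc_induct)
  case base then show ?case .
next
  case (step i)
  have "\<lfloor>x \<bullet> b / side L i\<rfloor> = \<lfloor>y \<bullet> b / side L i\<rfloor>" if "b \<in> Basis" for b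
    using floor_half_eq[of "x \<bullet> b / side L (Suc i)" "y \<bullet> b / side L (Suc i)"] that step
    by (simp add: idx_eq_iff side_Suc)
  then show ?case by (simp add: idx_eq_iff)
qed

lemma finite_nbrs: "finite nbrs"
  unfolding nbrs_def by (intro finite_imageI finite_PiE) auto

lemma nbrs_iff: "v \<in> nbrs \<longleftrightarrow> (\<forall>i\<in>Basis. v \<bullet> i \<in> {-1, 0, 1})"
proof
  assume *: "\<forall>i\<in>Basis. v \<bullet> i \<in> {-1, 0, 1}"
  have "v = (\<Sum>i\<in>Basis. restrict (\<lambda>i. v \<bullet> i) Basis i *\<^sub>R i)"
    by (simp add: euclidean_representation)
  moreover have "restrict (\<lambda>i. v \<bullet> i) Basis \<in> Basis \<rightarrow>\<^sub>E {-1, 0, 1}"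
    using * by auto
  ultimately show "v \<in> nbrs" unfolding nbrs_def by (rule image_eqI)
qed (auto simp: nbrs_def PiE_iff)

lemma zero_in_nbrs: "0 \<in> nbrs"
  by (simp add: nbrs_iff)

lemma card_nbrs_pos: "card (nbrs :: 'a::euclidean_space set) > 0"
  using finite_nbrs zero_in_nbrs card_gt_0_iff by blast

lemma countable_cells: "countable (cells L :: (nat \<times> 'a::euclidean_space) set)"
proof -
  have "range (idx L k) \<subseteq> (\<lambda>c. \<Sum>i\<in>Basis. of_int (c i) *\<^sub>R i) ` ((Basis :: 'a set) \<rightarrow>\<^sub>E UNIV)" for k
  proof
    fix m :: 'a assume "m \<in> range (idx L k)"
    then obtain x where x: "m = idx L k x" by auto
    have "m = (\<Sum>i\<in>Basis. of_int (restrict (\<lambda>i. \<lfloor>x \<bullet> i / side L k\<rfloor>) Basis i) *\<^sub>R i)"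
      unfolding x idx_def by simp
    then show "m \<in> (\<lambda>c. \<Sum>i\<in>Basis. of_int (c i) *\<^sub>R i) ` ((Basis :: 'a set) \<rightarrow>\<^sub>E UNIV)"
      by (rule image_eqI[where f = "\<lambda>c. \<Sum>i\<in>Basis. of_int (c i) *\<^sub>R i"]) auto
  qed
  moreover have "countable ((Basis :: 'a set) \<rightarrow>\<^sub>E (UNIV :: int set))"
    by (intro countable_PiE) auto
  ultimately have "countable (range (idx L k :: 'a \<Rightarrow> 'a))" for k
    by (meson countable_subset countable_image)
  then show ?thesis
    unfolding cells_def by (intro countable_SIGMA) auto
qed

lemma idx_add_nbr:
  assumes "L > 0" "v \<in> nbrs"
  shows "idx L k (x + side L k *\<^sub>R v) = idx L k x + v"
proof (rule euclidean_eqI)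
  fix i :: 'a assume i: "i \<in> Basis"
  obtain z :: int where z: "v \<bullet> i = of_int z"
    using assms(2) i by (auto simp: nbrs_iff dest!: bspec intro: that[of "-1"] that[of 0] that[of 1])
  have "(x + side L k *\<^sub>R v) \<bullet> i / side L k = x \<bullet> i / side L k + of_int z"
    using side_pos[OF assms(1), of k] by (simp add: inner_add_left z field_simps)
  then show "idx L k (x + side L k *\<^sub>R v) \<bullet> i = (idx L k x + v) \<bullet> i"
    by (simp add: idx_inner i inner_add_left z)
qed

lemma idx_add_nbr_in_cells:
  "L > 0 \<Longrightarrow> v \<in> nbrs \<Longrightarrow> (k, idx L k x + v) \<in> cells L"
  unfolding cells_def using idx_add_nbr[of L v k x] by (auto simp: image_iff intro: sym)

lemma idx_diff_in_nbrs:
  assumes "L > 0" "\<And>i. i \<in> Basis \<Longrightarrow> \<bar>(y - x) \<bullet> i\<bar> \<le> side L k"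
  shows "idx L k y - idx L k x \<in> nbrs"
  unfolding nbrs_iff
proof
  fix i :: 'a assume i: "i \<in> Basis"
  define a b where "a = x \<bullet> i / side L k" and "b = y \<bullet> i / side L k"
  have "\<bar>b - a\<bar> \<le> 1"
    using assms(2)[OF i] side_pos[OF assms(1), of k]
    unfolding a_def b_def by (simp add: diff_divide_distrib[symmetric] inner_diff_left)
  then have "\<lfloor>b\<rfloor> - \<lfloor>a\<rfloor> \<in> {-1, 0, 1}"
    by (auto; linarith)
  moreover have "(idx L k y - idx L k x) \<bullet> i = of_int (\<lfloor>b\<rfloor> - \<lfloor>a\<rfloor>)"
    by (simp add: i idx_inner inner_diff_left a_def b_def)
  ultimately show "(idx L k y - idx L k x) \<bullet> i \<in> {-1, 0, 1}" by auto
qed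

lemma idx_diff_nbrs_inner:
  assumes "L > 0" "idx L k y - idx L k x \<in> nbrs" "i \<in> Basis"
  shows "\<bar>(y - x) \<bullet> i\<bar> \<le> 2 * side L k"
proof -
  define a b where "a = x \<bullet> i / side L k" and "b = y \<bullet> i / side L k"
  have "of_int (\<lfloor>b\<rfloor> - \<lfloor>a\<rfloor>) \<in> {-1, 0, 1::real}"
    using assms(2,3) by (auto simp: nbrs_iff idx_inner inner_diff_left a_def b_def dest!: bspec)
  then have "\<bar>b - a\<bar> \<le> 2" by (auto; linarith)
  then show ?thesis
    using side_pos[OF assms(1), of k]
    unfolding a_def b_def by (simp add: diff_divide_distrib[symmetric] inner_diff_left field_simps)
qed

lemma idx_eq_inner:
  assumes "L > 0" "idx L k y = idx L k x" "i \<in> Basis"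
  shows "\<bar>(y - x) \<bullet> i\<bar> \<le> side L k"
proof -
  define a b where "a = x \<bullet> i / side L k" and "b = y \<bullet> i / side L k"
  have "\<lfloor>b\<rfloor> = \<lfloor>a\<rfloor>"
    using assms(2,3) by (auto simp: idx_eq_iff a_def b_def)
  then have "\<bar>b - a\<bar> \<le> 1" by linarith
  then show ?thesis
    using side_pos[OF assms(1), of k]
    unfolding a_def b_def by (simp add: diff_divide_distrib[symmetric] inner_diff_left field_simps)
qed

lemma norm_le_DIM_mult:
  fixes x :: "'a::euclidean_space"
  assumes "\<And>i. i \<in> Basis \<Longrightarrow> \<bar>x \<bullet> i\<bar> \<le> c"
  shows "norm x \<le> real DIM('a) * c"
proof -
  have "norm x \<le> (\<Sum>i\<in>Basis. \<bar>x \<bullet> i\<bar>)" by (rule norm_le_l1)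
  also have "\<dots> \<le> (\<Sum>i\<in>(Basis::'a set). c)" by (intro sum_mono assms)
  finally show ?thesis by simp
qed

lemma idx_measurable [measurable]: "idx L k \<in> borel_measurable borel"
  unfolding idx_def by measurable

lemma cell_measurable [measurable]: "{y. idx L k y = m} \<in> sets borel"
  by measurable

lemma emeasure_cell_le:
  fixes m :: "'a::euclidean_space"
  assumes "L > 0"
  shows "emeasure lborel {y. idx L k y = m} \<le> ennreal (side L k ^ DIM('a))"
proof -
  have s: "side L k > 0" using side_pos[OF assms] .
  have "{y. idx L k y = m} \<subseteq> cbox (side L k *\<^sub>R m) (side L k *\<^sub>R (m + One))"
  proof
    fix y assume "y \<in> {y. idx L k y = m}"
    then have y: "idx L k y = m" by simp
    show "y \<in> cbox (side L k *\<^sub>R m) (side L k *\<^sub>R (m + One))"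
      unfolding mem_box
    proof
      fix i :: 'a assume i: "i \<in> Basis"
      have "m \<bullet> i = of_int \<lfloor>y \<bullet> i / side L k\<rfloor>" using idx_inner[OF i, of L k y] y by simp
      then have "m \<bullet> i \<le> y \<bullet> i / side L k" "y \<bullet> i / side L k \<le> m \<bullet> i + 1" by linarith+
      then show "(side L k *\<^sub>R m) \<bullet> i \<le> y \<bullet> i \<and> y \<bullet> i \<le> (side L k *\<^sub>R (m + One)) \<bullet> i"
        using s i by (simp add: field_simps inner_add_left)
    qed
  qed
  then have "emeasure lborel {y. idx L k y = m} \<le> emeasure lborel (cbox (side L k *\<^sub>R m) (side L k *\<^sub>R (m + One)))"
    by (intro emeasure_mono) auto
  also have "\<dots> = ennreal (side L k ^ DIM('a))"
    using s by (subst emeasure_lborel_cbox) (auto simp: inner_add_left algebra_simps)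
  finally show ?thesis .
qed

lemma side_scale_exists:
  assumes "0 < R" "R \<le> L"
  shows "\<exists>k. side L (Suc k) < R \<and> R \<le> side L k"
proof -
  obtain N where N: "L / R < 2 ^ N" using real_arch_pow[of 2 "L / R"] by auto
  have "side L N < R" using N assms by (simp add: side_def field_simps)
  \<comment> \<open>The least generation whose side is below R is not 0, because
    \<open>side L 0\<close> is L >= R; its predecessor is the scale wanted.\<close>
  moreover define k where "k = (LEAST k. side L k < R)"
  ultimately have 1: "side L k < R" by (metis LeastI)
  have "k \<noteq> 0" using 1 assms by (auto simp: side_def intro!: Nat.gr0I)
  then obtain j where j: "k = Suc j" by (cases k) auto
  have "\<not> side L j < R" using not_less_Least[of j "\<lambda>k. side L k < R"] j k_def by auto
  with 1 j show ?thesis by (intro exI[of _ j]) auto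
qed

section \<open>Sums over countable index sets, and covers by balls or cells\<close>

lemma nn_integral_count_space_by_indicator:
  "(\<integral>\<^sup>+ y. f y \<partial>count_space X) = (\<integral>\<^sup>+ y. f y * indicator X y \<partial>count_space UNIV)"
  by (cases "X = UNIV") (auto simp: nn_integral_count_space_indicator)

lemma nn_integral_count_space_Sigma:
  fixes h :: "'a \<times> 'b \<Rightarrow> ennreal"
  shows "(\<integral>\<^sup>+ z. h z \<partial>count_space (Sigma A B)) = (\<integral>\<^sup>+ a. \<integral>\<^sup>+ b. h (a, b) \<partial>count_space (B a) \<partial>count_space A)"
proof -
  have "(\<integral>\<^sup>+ z. h z \<partial>count_space (Sigma A B)) = (\<integral>\<^sup>+ a. \<integral>\<^sup>+ b. h (a, b) * indicator (Sigma A B) (a, b) \<partial>count_space UNIV \<partial>count_space UNIV)"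
    unfolding nn_integral_count_space_by_indicator[where f = h] by (rule nn_integral_fst_count_space[symmetric])
  also have "\<dots> = (\<integral>\<^sup>+ a. (\<integral>\<^sup>+ b. h (a, b) * indicator (B a) b \<partial>count_space UNIV) * indicator A a \<partial>count_space UNIV)"
    by (intro nn_integral_cong) (auto split: split_indicator intro!: nn_integral_cong)
  finally show ?thesis by (simp add: nn_integral_count_space_by_indicator[symmetric])
qed

lemma nn_integral_count_space_Sigma_le:
  fixes h :: "'a \<times> 'b \<Rightarrow> ennreal"
  assumes "\<And>a. a \<in> A \<Longrightarrow> finite (B a)"
    "\<And>a b. a \<in> A \<Longrightarrow> b \<in> B a \<Longrightarrow> h (a, b) \<le> g a"
  shows "(\<integral>\<^sup>+ z. h z \<partial>count_space (Sigma A B)) \<le> (\<integral>\<^sup>+ a. of_nat (card (B a)) * g a \<partial>count_space A)"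
  unfolding nn_integral_count_space_Sigma
proof (intro nn_integral_mono)
  fix a assume "a \<in> space (count_space A)"
  then have a: "a \<in> A" by simp
  have "(\<integral>\<^sup>+ b. h (a, b) \<partial>count_space (B a)) = (\<Sum>b\<in>B a. h (a, b))"
    by (rule nn_integral_count_space_finite[OF assms(1)[OF a]])
  also have "\<dots> \<le> (\<Sum>b\<in>B a. g a)" by (intro sum_mono assms(2) a)
  finally show "(\<integral>\<^sup>+ b. h (a, b) \<partial>count_space (B a)) \<le> of_nat (card (B a)) * g a"
    by simp
qed

text \<open>\<open>hcontent\<close> ranges over sequences of balls, so a countable index set is
  embedded in the naturals and the remaining indices get radius 0, that is, an empty ball of cost
  0.\<close>

lemma hcontent_le_cover:
  assumes "countable I" "\<And>i. i \<in> I \<Longrightarrow> 0 \<le> r i" "E \<subseteq> (\<Union>i\<in>I. ball (x i) (r i))"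
  shows "hcontent \<beta> E \<le> (\<integral>\<^sup>+ i. ennreal (r i powr \<beta>) \<partial>count_space I)"
proof -
  define J where "J = to_nat_on I ` I"
  define X R where "X j = x (from_nat_into I j)" and "R j = (if j \<in> J then r (from_nat_into I j) else 0)" for j
  have inv: "from_nat_into I (to_nat_on I i) = i" if "i \<in> I" for i
    using that assms(1) by simp
  have "R j \<ge> 0" for j
    using assms(2) inv unfolding R_def J_def by auto
  moreover have "E \<subseteq> (\<Union>j. ball (X j) (R j))"
  proof
    fix y assume "y \<in> E"
    then obtain i where "i \<in> I" "y \<in> ball (x i) (r i)" using assms(3) by auto
    then have "y \<in> ball (X (to_nat_on I i)) (R (to_nat_on I i))"
      by (simp add: X_def R_def J_def inv)
    then show "y \<in> (\<Union>j. ball (X j) (R j))" by blast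
  qed
  ultimately have "hcontent \<beta> E \<le> (\<Sum>j. ennreal (R j powr \<beta>))"
    unfolding hcontent_def by (intro INF_lower2[of "(X, R)"]) auto
  also have "\<dots> = (\<integral>\<^sup>+ j. ennreal (R j powr \<beta>) \<partial>count_space UNIV)"
    by (simp add: nn_integral_count_space_nat)
  also have "\<dots> = (\<integral>\<^sup>+ j. ennreal (R j powr \<beta>) \<partial>count_space J)"
    by (intro nn_integral_count_space_eq) (auto simp: R_def)
  also have "\<dots> \<le> (\<integral>\<^sup>+ i. ennreal (R (to_nat_on I i) powr \<beta>) \<partial>count_space I)"
    unfolding J_def by (rule nn_integral_count_space_image_le)
  also have "\<dots> = (\<integral>\<^sup>+ i. ennreal (r i powr \<beta>) \<partial>count_space I)"
    by (intro nn_integral_cong) (auto simp: R_def J_def inv)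
  finally show ?thesis .
qed

lemma hcontent_mono: "A \<subseteq> B \<Longrightarrow> hcontent \<beta> A \<le> hcontent \<beta> B"
  unfolding hcontent_def by (intro INF_superset_mono) auto

text \<open>Balls missing E are discarded; any other ball is replaced by the cells around one point
  \<open>y i\<close> of E inside it. Every point of E in that ball is closer than 2 r to
  \<open>y i\<close>, hence in a neighbouring cell once the side is large enough.\<close>

lemma hcontent_cells_cover:
  fixes E :: "'a::euclidean_space set"
  assumes "L > 0" "\<delta> > 0" and diam: "\<And>x y. x \<in> E \<Longrightarrow> y \<in> E \<Longrightarrow> dist x y < L"
    and less: "hcontent \<delta> E < \<eta>"
  shows "\<exists>Q\<subseteq>cells L. (\<forall>x\<in>E. \<exists>k. (k, idx L k x) \<in> Q) \<and>
    (\<integral>\<^sup>+ c. ennreal (side L (fst c) powr \<delta>) \<partial>count_space Q)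
      \<le> ennreal (real (card (nbrs :: 'a set)) * 4 powr \<delta>) * \<eta>"
proof -
  obtain x r where r: "\<And>i. 0 \<le> r i" and cov: "E \<subseteq> (\<Union>i::nat. ball (x i) (r i))"
    and sum: "(\<Sum>i. ennreal (r i powr \<delta>)) < \<eta>"
    using less unfolding hcontent_def by (auto simp: INF_less_iff)
  define I where "I = {i. E \<inter> ball (x i) (r i) \<noteq> {}}"
  have "\<forall>i\<in>I. \<exists>y. y \<in> E \<inter> ball (x i) (r i)" by (auto simp: I_def)
  then obtain y where y: "\<And>i. i \<in> I \<Longrightarrow> y i \<in> E \<and> y i \<in> ball (x i) (r i)"
    by (metis IntE)
  have rpos: "r i > 0" if "i \<in> I" for i
    using y[OF that] r[of i] by (cases "r i = 0") auto
  \<comment> \<open>No cell is larger than L, but L also exceeds all distances within E, so the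
    scale may be capped at L. The bracket then gives side < 2 R <= 4 r, the origin of
    \<open>4 powr \<delta>\<close>.\<close>
  define R where "R i = min (2 * r i) L" for i
  have "\<forall>i\<in>I. \<exists>k. side L (Suc k) < R i \<and> R i \<le> side L k"
    using rpos assms(1) by (intro ballI side_scale_exists) (auto simp: R_def)
  then obtain k where k: "\<And>i. i \<in> I \<Longrightarrow> side L (Suc (k i)) < R i \<and> R i \<le> side L (k i)"
    by metis
  define \<phi> where "\<phi> = (\<lambda>(i, v). (k i, idx L (k i) (y i) + v))"
  define Q where "Q = \<phi> ` (I \<times> nbrs)"
  have "Q \<subseteq> cells L"
    unfolding Q_def \<phi>_def using idx_add_nbr_in_cells[OF assms(1)] by auto
  moreover have "\<forall>z\<in>E. \<exists>k. (k, idx L k z) \<in> Q"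
  proof
    fix z assume z: "z \<in> E"
    then obtain i where i: "z \<in> ball (x i) (r i)" using cov by auto
    then have iI: "i \<in> I" using z by (auto simp: I_def)
    have "dist z (y i) < 2 * r i"
      using i y[OF iI] dist_triangle2[of z "y i" "x i"] by (auto simp: dist_commute)
    moreover have "dist z (y i) < L" using diam z y[OF iI] by auto
    ultimately have "norm (z - y i) \<le> side L (k i)"
      using k[OF iI] unfolding R_def dist_norm by auto
    then have "idx L (k i) z - idx L (k i) (y i) \<in> nbrs"
      using Basis_le_norm[of _ "z - y i"] by (intro idx_diff_in_nbrs assms(1)) (meson order_trans)
    then have "\<phi> (i, idx L (k i) z - idx L (k i) (y i)) \<in> Q"
      unfolding Q_def using iI by (intro imageI) auto
    then show "\<exists>k. (k, idx L k z) \<in> Q" by (auto simp: \<phi>_def)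
  qed
  moreover have "(\<integral>\<^sup>+ c. ennreal (side L (fst c) powr \<delta>) \<partial>count_space Q)
      \<le> ennreal (real (card (nbrs :: 'a set)) * 4 powr \<delta>) * \<eta>"
  proof -
    have "(\<integral>\<^sup>+ c. ennreal (side L (fst c) powr \<delta>) \<partial>count_space Q)
        \<le> (\<integral>\<^sup>+ z. ennreal (side L (fst (\<phi> z)) powr \<delta>) \<partial>count_space (I \<times> nbrs))"
      unfolding Q_def by (rule nn_integral_count_space_image_le)
    also have "\<dots> \<le> (\<integral>\<^sup>+ i. of_nat (card (nbrs :: 'a set)) * ennreal ((4 * r i) powr \<delta>) \<partial>count_space I)"
    proof (intro nn_integral_count_space_Sigma_le)
      fix i and v :: 'a assume i: "i \<in> I"
      have "side L (k i) \<le> 4 * r i" using k[OF i] by (auto simp: side_Suc R_def)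
      then show "ennreal (side L (fst (\<phi> (i, v))) powr \<delta>) \<le> ennreal ((4 * r i) powr \<delta>)"
        using side_pos[OF assms(1), of "k i"] assms(2)
        by (auto simp: \<phi>_def intro!: ennreal_leI powr_mono2)
    qed (auto simp: finite_nbrs)
    also have "\<dots> \<le> (\<integral>\<^sup>+ i. of_nat (card (nbrs :: 'a set)) * ennreal ((4 * r i) powr \<delta>) \<partial>count_space UNIV)"
      by (subst nn_integral_count_space_indicator[of I], simp, intro nn_integral_mono)
        (auto split: split_indicator)
    also have "\<dots> = (\<integral>\<^sup>+ i. ennreal (real (card (nbrs :: 'a set)) * 4 powr \<delta>) * ennreal (r i powr \<delta>) \<partial>count_space UNIV)"
      using r by (intro nn_integral_cong)
        (auto simp: powr_mult ennreal_mult[symmetric] ennreal_of_nat_eq_real_of_nat mult.assoc)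
    also have "\<dots> = ennreal (real (card (nbrs :: 'a set)) * 4 powr \<delta>) * (\<Sum>i. ennreal (r i powr \<delta>))"
      by (simp add: nn_integral_cmult nn_integral_count_space_nat)
    also have "\<dots> \<le> ennreal (real (card (nbrs :: 'a set)) * 4 powr \<delta>) * \<eta>"
      using sum by (intro mult_left_mono) auto
    finally show ?thesis .
  qed
  ultimately show ?thesis by blast
qed

section \<open>From the Choquet integral to weights on cells\<close>

lemma two_powr_bracket:
  fixes t :: real
  assumes "t > 0"
  shows "\<exists>q::int. 2 powr (real_of_int q) < t \<and> t \<le> 2 powr (real_of_int q + 1)"
proof -
  define q where "q = \<lceil>log 2 t\<rceil> - 1"
  have "real_of_int q < log 2 t" "log 2 t \<le> real_of_int q + 1" unfolding q_def by linarith+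
  then have "2 powr (real_of_int q) < t" "t \<le> 2 powr (real_of_int q + 1)"
    using assms by (simp_all add: less_log_iff log_le_iff)
  then show ?thesis by auto
qed

text \<open>The content of a superlevel set decreases with the height. On the interval
  \<open>J q\<close>, of length 2^(q-1) and ending at 2^q, it is at least its value at 2^q, and
  these intervals are disjoint.\<close>

lemma choquet_hcontent_dyadic_sum_le:
  "(\<integral>\<^sup>+ q. ennreal (2 powr (real_of_int q - 1)) * hcontent \<delta> {x\<in>\<Omega>. F x > 2 powr (real_of_int q)} \<partial>count_space UNIV)
     \<le> choquet_hcontent \<delta> \<Omega> F"
proof -
  define h where "h t = hcontent \<delta> {x\<in>\<Omega>. F x > t}" for t
  have anti: "h t \<le> h s" if "s \<le> t" for s t
    unfolding h_def using that by (intro hcontent_mono) auto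
  define J where "J q = {2 powr (real_of_int q - 1)<..2 powr (real_of_int q)}" for q
  have "(\<integral>\<^sup>+ q. ennreal (2 powr (real_of_int q - 1)) * h (2 powr (real_of_int q)) \<partial>count_space UNIV)
      = (\<integral>\<^sup>+ q. \<integral>\<^sup>+ t. indicator (J q) t * h (2 powr (real_of_int q)) \<partial>lborel \<partial>count_space UNIV)"
  proof (intro nn_integral_cong)
    fix q :: int
    have "2 powr real_of_int q = 2 * 2 powr (real_of_int q - 1)" by (simp add: powr_diff)
    then show "ennreal (2 powr (real_of_int q - 1)) * h (2 powr (real_of_int q)) = (\<integral>\<^sup>+ t. indicator (J q) t * h (2 powr (real_of_int q)) \<partial>lborel)"
      by (simp add: nn_integral_multc J_def)
  qed
  also have "\<dots> = (\<integral>\<^sup>+ t. \<integral>\<^sup>+ q. indicator (J q) t * h (2 powr (real_of_int q)) \<partial>count_space UNIV \<partial>lborel)"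
    by (rule nn_integral_count_space_nn_integral[symmetric]) (auto simp: J_def)
  also have "\<dots> \<le> (\<integral>\<^sup>+ t. indicator {0..} t * h t \<partial>lborel)"
  proof (intro nn_integral_mono)
    fix t :: real
    show "(\<integral>\<^sup>+ q. indicator (J q) t * h (2 powr (real_of_int q)) \<partial>count_space UNIV) \<le> indicator {0..} t * h t"
    proof (cases "\<exists>q. t \<in> J q")
      case True
      then obtain q where q: "t \<in> J q" by blast
      have uniq: "q' = q" if "t \<in> J q'" for q'
      proof -
        have "2 powr (real_of_int q - 1) < 2 powr real_of_int q'" "2 powr (real_of_int q' - 1) < 2 powr real_of_int q"
          using q that by (simp_all add: J_def del: powr_less_cancel_iff)
        then show ?thesis by simp
      qed
      have "(\<integral>\<^sup>+ q. indicator (J q) t * h (2 powr (real_of_int q)) \<partial>count_space UNIV) = (\<Sum>q\<in>{q}. indicator (J q) t * h (2 powr (real_of_int q)))"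
        using uniq by (intro nn_integral_count_space') (auto split: split_indicator)
      also have "\<dots> \<le> indicator {0..} t * h t"
        using q anti[of t "2 powr (real_of_int q)"] powr_ge_zero[of 2 "real_of_int q - 1"]
        by (auto simp: J_def split: split_indicator simp del: powr_ge_zero)
      finally show ?thesis .
    qed (auto simp: nn_integral_0_iff_AE AE_count_space split: split_indicator)
  qed
  finally show ?thesis unfolding h_def choquet_hcontent_def .
qed

text \<open>The weight of a cell collects 2^(q+1) for every height 2^q whose cover uses it. If 2^q <
  F x <= 2^(q+1), some cell around x is used at height 2^q and weighs at least F x. The factor 4 is
  the ratio of 2^(q+1) to the length 2^(q-1) of the dyadic interval in the Choquet sum.\<close>

lemma choquet_weights:
  fixes \<Omega> :: "'a::euclidean_space set"
  assumes "L > 0" "\<delta> > 0" and diam: "\<And>x y. x \<in> \<Omega> \<Longrightarrow> y \<in> \<Omega> \<Longrightarrow> dist x y < L"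
    and fin: "choquet_hcontent \<delta> \<Omega> F < \<infinity>" and "\<epsilon> > (0::real)"
  shows "\<exists>b :: nat \<Rightarrow> 'a \<Rightarrow> real. (\<forall>k m. 0 \<le> b k m) \<and>
    (\<forall>x\<in>\<Omega>. F x > 0 \<longrightarrow> (\<exists>k. F x \<le> b k (idx L k x))) \<and>
    (\<integral>\<^sup>+ c. ennreal (b (fst c) (snd c) * side L (fst c) powr \<delta>) \<partial>count_space (cells L))
      \<le> ennreal (4 * (real (card (nbrs :: 'a set)) * 4 powr \<delta>)) * (choquet_hcontent \<delta> \<Omega> F + ennreal \<epsilon>)"
proof -
  define K where "K = choquet_hcontent \<delta> \<Omega> F"
  define C where "C = real (card (nbrs :: 'a set)) * 4 powr \<delta>"
  define E where "E q = {x\<in>\<Omega>. F x > 2 powr (real_of_int q)}" for q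
  \<comment> \<open>Allowed excess of the cover at height 2^q: multiplied by 2^(q+1) and summed over
    all integers q through the injection \<open>to_nat\<close>, it amounts to at most 4
    \<epsilon>.\<close>
  define e where "e q = \<epsilon> * 2 powr (- real_of_int q) * (1/2) ^ to_nat q" for q :: int
  have e_pos: "e q > 0" for q using assms(5) by (simp add: e_def)
  have sumE: "(\<integral>\<^sup>+ q. ennreal (2 powr (real_of_int q - 1)) * hcontent \<delta> (E q) \<partial>count_space UNIV) \<le> K"
    unfolding E_def K_def by (rule choquet_hcontent_dyadic_sum_le)
  have finE: "hcontent \<delta> (E q) < \<infinity>" for q
  proof -
    have "ennreal (2 powr (real_of_int q - 1)) * hcontent \<delta> (E q)
        \<le> (\<integral>\<^sup>+ q. ennreal (2 powr (real_of_int q - 1)) * hcontent \<delta> (E q) \<partial>count_space UNIV)"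
      by (rule nn_integral_ge_point) simp
    also have "\<dots> < \<infinity>" using sumE fin unfolding K_def by (metis order.strict_trans1)
    finally show ?thesis by (auto simp: ennreal_mult_less_top)
  qed
  \<comment> \<open>The infimum defining the content need not be attained, so the cover is offered a
    strictly larger bound; it is strictly larger because the content is finite.\<close>
  have lt: "hcontent \<delta> (E q) < hcontent \<delta> (E q) + ennreal (e q)" for q
    using finE[of q] e_pos[of q]
    by (cases "hcontent \<delta> (E q)" rule: ennreal_cases)
      (auto simp: ennreal_plus[symmetric] ennreal_less_iff simp del: ennreal_plus)
  have "\<exists>Q\<subseteq>cells L. (\<forall>x\<in>E q. \<exists>k. (k, idx L k x) \<in> Q) \<and>
    (\<integral>\<^sup>+ c. ennreal (side L (fst c) powr \<delta>) \<partial>count_space Q) \<le> ennreal C * (hcontent \<delta> (E q) + ennreal (e q))" for q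
    unfolding C_def using diam lt[of q]
    by (intro hcontent_cells_cover assms(1,2)) (auto simp: E_def)
  then obtain Q where Q: "\<And>q. Q q \<subseteq> cells L" "\<And>q x. x \<in> E q \<Longrightarrow> \<exists>k. (k, idx L k x) \<in> Q q"
    "\<And>q. (\<integral>\<^sup>+ c. ennreal (side L (fst c) powr \<delta>) \<partial>count_space (Q q)) \<le> ennreal C * (hcontent \<delta> (E q) + ennreal (e q))"
    by metis
  define B where "B c = (\<integral>\<^sup>+ q. ennreal (2 powr (real_of_int q + 1)) * indicator (Q q) c \<partial>count_space UNIV)" for c
  have C0: "C \<ge> 0" by (simp add: C_def)
  have "(\<integral>\<^sup>+ c. B c * ennreal (side L (fst c) powr \<delta>) \<partial>count_space (cells L))
      = (\<integral>\<^sup>+ c. \<integral>\<^sup>+ q. ennreal (2 powr (real_of_int q + 1)) * indicator (Q q) c * ennreal (side L (fst c) powr \<delta>) \<partial>count_space UNIV \<partial>count_space (cells L))"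
    unfolding B_def by (simp add: nn_integral_multc)
  also have "\<dots> = (\<integral>\<^sup>+ q. \<integral>\<^sup>+ c. ennreal (2 powr (real_of_int q + 1)) * indicator (Q q) c * ennreal (side L (fst c) powr \<delta>) \<partial>count_space (cells L) \<partial>count_space UNIV)"
    by (rule nn_integral_count_space_nn_integral) auto
  also have "\<dots> = (\<integral>\<^sup>+ q. ennreal (2 powr (real_of_int q + 1)) * (\<integral>\<^sup>+ c. ennreal (side L (fst c) powr \<delta>) \<partial>count_space (Q q)) \<partial>count_space UNIV)"
  proof (intro nn_integral_cong)
    fix q :: int
    have "(\<integral>\<^sup>+ c. ennreal (2 powr (real_of_int q + 1)) * indicator (Q q) c * ennreal (side L (fst c) powr \<delta>) \<partial>count_space (cells L))
       = ennreal (2 powr (real_of_int q + 1)) * (\<integral>\<^sup>+ c. ennreal (side L (fst c) powr \<delta>) * indicator (Q q) c \<partial>count_space (cells L))"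
      by (subst nn_integral_cmult[symmetric]) (auto simp: mult_ac)
    also have "(\<integral>\<^sup>+ c. ennreal (side L (fst c) powr \<delta>) * indicator (Q q) c \<partial>count_space (cells L))
       = (\<integral>\<^sup>+ c. ennreal (side L (fst c) powr \<delta>) * indicator (Q q) c \<partial>count_space (Q q))"
      using Q(1)[of q] by (intro nn_integral_count_space_eq) auto
    also have "\<dots> = (\<integral>\<^sup>+ c. ennreal (side L (fst c) powr \<delta>) \<partial>count_space (Q q))"
      by (intro nn_integral_cong) auto
    finally show "(\<integral>\<^sup>+ c. ennreal (2 powr (real_of_int q + 1)) * indicator (Q q) c * ennreal (side L (fst c) powr \<delta>) \<partial>count_space (cells L))
       = ennreal (2 powr (real_of_int q + 1)) * (\<integral>\<^sup>+ c. ennreal (side L (fst c) powr \<delta>) \<partial>count_space (Q q))" .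
  qed
  also have "\<dots> \<le> (\<integral>\<^sup>+ q. ennreal (4 * C) * (ennreal (2 powr (real_of_int q - 1)) * hcontent \<delta> (E q))
        + ennreal (2 * C * \<epsilon>) * ennreal ((1/2) ^ to_nat (q::int)) \<partial>count_space UNIV)"
  proof (intro nn_integral_mono)
    fix q :: int
    have "ennreal (2 powr (real_of_int q + 1)) * (\<integral>\<^sup>+ c. ennreal (side L (fst c) powr \<delta>) \<partial>count_space (Q q))
        \<le> ennreal (2 powr (real_of_int q + 1)) * (ennreal C * (hcontent \<delta> (E q) + ennreal (e q)))"
      by (intro mult_left_mono Q(3)) auto
    also have "\<dots> = ennreal (2 powr (real_of_int q + 1) * C) * hcontent \<delta> (E q) + ennreal (2 powr (real_of_int q + 1) * C * e q)"
      using C0 e_pos[of q] by (simp add: ennreal_mult distrib_left mult.assoc)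
    also have "2 powr (real_of_int q + 1) * C = 4 * C * 2 powr (real_of_int q - 1)"
      by (simp add: powr_add powr_diff)
    also have "ennreal (4 * C * 2 powr (real_of_int q - 1)) * hcontent \<delta> (E q)
        = ennreal (4 * C) * (ennreal (2 powr (real_of_int q - 1)) * hcontent \<delta> (E q))"
      using C0 by (simp add: ennreal_mult mult.assoc)
    also have "4 * C * 2 powr (real_of_int q - 1) * e q = 2 * C * \<epsilon> * (1/2) ^ to_nat q"
      by (simp add: e_def powr_diff powr_minus)
    finally show "ennreal (2 powr (real_of_int q + 1)) * (\<integral>\<^sup>+ c. ennreal (side L (fst c) powr \<delta>) \<partial>count_space (Q q))
      \<le> ennreal (4 * C) * (ennreal (2 powr (real_of_int q - 1)) * hcontent \<delta> (E q))
        + ennreal (2 * C * \<epsilon>) * ennreal ((1/2) ^ to_nat (q::int))"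
      using C0 assms(5) by (simp add: ennreal_mult)
  qed
  also have "\<dots> = ennreal (4 * C) * (\<integral>\<^sup>+ q. ennreal (2 powr (real_of_int q - 1)) * hcontent \<delta> (E q) \<partial>count_space UNIV)
        + ennreal (2 * C * \<epsilon>) * (\<integral>\<^sup>+ q. ennreal ((1/2) ^ to_nat (q::int)) \<partial>count_space UNIV)"
    by (simp add: nn_integral_add nn_integral_cmult)
  also have "\<dots> \<le> ennreal (4 * C) * K + ennreal (2 * C * \<epsilon>) * ennreal 2"
  proof (intro add_mono mult_left_mono sumE)
    have "(\<integral>\<^sup>+ q. ennreal ((1/2) ^ to_nat (q::int)) \<partial>count_space UNIV)
        = (\<integral>\<^sup>+ j. ennreal ((1/2) ^ j) \<partial>count_space (range (to_nat :: int \<Rightarrow> nat)))"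
      by (rule nn_integral_bij_count_space) (auto simp: bij_betw_def)
    also have "\<dots> \<le> (\<integral>\<^sup>+ j. ennreal ((1/2) ^ j) \<partial>count_space UNIV)"
    proof (cases "range (to_nat :: int \<Rightarrow> nat) = UNIV")
      case False
      then show ?thesis
        by (subst nn_integral_count_space_indicator, simp, intro nn_integral_mono) (auto split: split_indicator)
    qed simp
    also have "\<dots> = (\<Sum>j. ennreal ((1/2) ^ j))" by (rule nn_integral_count_space_nat)
    also have "\<dots> = ennreal 2"
      by (subst suminf_ennreal2) (auto simp: suminf_geometric summable_geometric)
    finally show "(\<integral>\<^sup>+ q. ennreal ((1/2) ^ to_nat (q::int)) \<partial>count_space UNIV) \<le> ennreal 2" .
  qed auto
  also have "ennreal (2 * C * \<epsilon>) * ennreal 2 = ennreal (4 * C) * ennreal \<epsilon>"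
    using C0 assms(5) by (simp add: ennreal_mult[symmetric] del: ennreal_numeral)
  finally have main: "(\<integral>\<^sup>+ c. B c * ennreal (side L (fst c) powr \<delta>) \<partial>count_space (cells L))
      \<le> ennreal (4 * C) * (K + ennreal \<epsilon>)" by (simp add: distrib_left)
  \<comment> \<open>Infinitely many heights may use the same cell, so finiteness of its weight is
    deduced from the total: the side is positive, and an infinite weight would make the sum
    infinite. Outside \<open>cells L\<close> no cover contributes.\<close>
  have B_fin: "B c < \<infinity>" for c
  proof (cases "c \<in> cells L")
    case True
    then have "B c * ennreal (side L (fst c) powr \<delta>) \<le> (\<integral>\<^sup>+ c. B c * ennreal (side L (fst c) powr \<delta>) \<partial>count_space (cells L))"
      by (rule nn_integral_ge_point)
    also have "\<dots> < \<infinity>"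
      using main fin unfolding K_def[symmetric] by (elim order.strict_trans1) (simp add: ennreal_mult_less_top)
    finally show ?thesis using side_pos[OF assms(1), of "fst c"]
      by (auto simp: ennreal_mult_less_top)
  next
    case False
    then have "c \<notin> Q q" for q using Q(1)[of q] by auto
    then show ?thesis unfolding B_def by simp
  qed
  define b where "b k m = enn2real (B (k, m))" for k m
  have bB: "ennreal (b k m) = B (k, m)" for k m
    using B_fin[of "(k, m)"] by (simp add: b_def)
  have "\<exists>k. F x \<le> b k (idx L k x)" if x: "x \<in> \<Omega>" "F x > 0" for x
  proof -
    obtain q :: int where q: "2 powr (real_of_int q) < F x" "F x \<le> 2 powr (real_of_int q + 1)"
      using two_powr_bracket[OF x(2)] by blast
    then have "x \<in> E q" using x by (auto simp: E_def)
    then obtain k where k: "(k, idx L k x) \<in> Q q" using Q(2) by blast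
    have "ennreal (F x) \<le> ennreal (2 powr (real_of_int q + 1)) * indicator (Q q) (k, idx L k x)"
      using q k by (simp add: ennreal_leI)
    also have "\<dots> \<le> B (k, idx L k x)" unfolding B_def by (rule nn_integral_ge_point) simp
    finally have "ennreal (F x) \<le> ennreal (b k (idx L k x))" by (simp add: bB)
    then show ?thesis by (auto simp: ennreal_le_iff b_def)
  qed
  moreover have "(\<integral>\<^sup>+ c. ennreal (b (fst c) (snd c) * side L (fst c) powr \<delta>) \<partial>count_space (cells L))
      \<le> ennreal (4 * C) * (K + ennreal \<epsilon>)"
  proof -
    have "ennreal (b (fst c) (snd c) * side L (fst c) powr \<delta>) = B c * ennreal (side L (fst c) powr \<delta>)" for c
      using bB[of "fst c" "snd c"] by (subst ennreal_mult) (auto simp: b_def)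
    then show ?thesis using main by simp
  qed
  ultimately show ?thesis unfolding C_def K_def by (intro exI[of _ b]) (auto simp: b_def)
qed

text \<open>No single term exceeds the total T, so \<open>c i powr r\<close> is at most
  \<open>T powr (r - 1)\<close> times \<open>c i\<close>: the inclusion of l^1 in l^r.\<close>

lemma nn_integral_powr_le:
  fixes c :: "'i \<Rightarrow> real"
  assumes "\<And>i. i \<in> A \<Longrightarrow> 0 \<le> c i" "(\<integral>\<^sup>+ i. ennreal (c i) \<partial>count_space A) \<le> ennreal T" "T > 0" "r \<ge> 1"
  shows "(\<integral>\<^sup>+ i. ennreal (c i powr r) \<partial>count_space A) \<le> ennreal (T powr r)"
proof -
  have "(\<integral>\<^sup>+ i. ennreal (c i powr r) \<partial>count_space A) \<le> (\<integral>\<^sup>+ i. ennreal (T powr (r - 1)) * ennreal (c i) \<partial>count_space A)"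
  proof (intro nn_integral_mono)
    fix i assume "i \<in> space (count_space A)"
    then have i: "i \<in> A" by simp
    have "ennreal (c i) \<le> ennreal T"
      using nn_integral_ge_point[OF i, of "\<lambda>i. ennreal (c i)"] assms(2) by auto
    then have "c i \<le> T" using assms(1)[OF i] assms(3) by (simp add: ennreal_le_iff)
    then have "c i powr (r - 1) * c i \<le> T powr (r - 1) * c i"
      using assms(1)[OF i] assms(4) by (intro mult_right_mono powr_mono2) auto
    moreover have "c i powr r = c i powr (r - 1) * c i"
      using assms(1)[OF i] by (cases "c i = 0") (auto simp: powr_diff)
    ultimately show "ennreal (c i powr r) \<le> ennreal (T powr (r - 1)) * ennreal (c i)"
      using assms(1)[OF i] by (simp add: ennreal_mult[symmetric] ennreal_leI)
  qed
  also have "\<dots> = ennreal (T powr (r - 1)) * (\<integral>\<^sup>+ i. ennreal (c i) \<partial>count_space A)"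
    by (simp add: nn_integral_cmult)
  also have "\<dots> \<le> ennreal (T powr (r - 1)) * ennreal T"
    by (intro mult_left_mono assms(2)) auto
  also have "\<dots> = ennreal (T powr r)"
    using assms(3) by (simp add: ennreal_mult[symmetric] powr_diff)
  finally show ?thesis .
qed

section \<open>The weak type estimate\<close>

text \<open>The cell (k, m) with all its dyadic descendants. One common point identifies a
  descendant because the grids are nested.\<close>

definition below :: "real \<Rightarrow> nat \<Rightarrow> 'a::euclidean_space \<Rightarrow> (nat \<times> 'a) set" where
  "below L k m = {(j, m'). k \<le> j \<and> (\<exists>y. idx L j y = m' \<and> idx L k y = m)}"

lemma below_cells: "below L k m \<subseteq> cells L"
  by (auto simp: below_def cells_def)

lemma idx_in_below: "k \<le> j \<Longrightarrow> (j, idx L j y) \<in> below L k (idx L k y)"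
  by (auto simp: below_def)

lemma idx_of_below: "(j, idx L j y) \<in> below L k m \<Longrightarrow> k \<le> j \<and> idx L k y = m"
  unfolding below_def using idx_eq_coarser by blast

text \<open>Averaging over the threshold \<open>\<tau>\<close> replaces the packing argument that is usually needed because
  the content is not additive: for each \<open>\<tau>\<close> the cells at which the partial sums of the weights along
  a branch cross \<open>\<tau>\<close> cover the large values.\<close>
lemma threshold_cells_cover:
  fixes b :: "nat \<Rightarrow> 'a::euclidean_space \<Rightarrow> real"
  assumes b: "\<And>k m. 0 \<le> b k m" and "\<Lambda> > 0" "\<mu> > 0"
    and sum: "(\<integral>\<^sup>+ c. ennreal (b (fst c) (snd c) * a (fst c)) \<partial>count_space (cells L)) \<le> ennreal \<mu>"
    and a: "\<And>k. 0 \<le> a k"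
  shows "\<exists>G\<subseteq>cells L. (\<integral>\<^sup>+ c. ennreal (a (fst c)) \<partial>count_space G) \<le> ennreal (2 * \<mu> / \<Lambda>) \<and>
    (\<forall>k x. (\<Sum>j<k. b j (idx L j x)) > \<Lambda> \<longrightarrow> (\<exists>j\<le>k. (j, idx L j x) \<in> G))"
proof -
  define S where "S k x = (\<Sum>j<k. b j (idx L j x))" for k x
  define G where "G \<tau> = {(k, m). \<exists>x. idx L k x = m \<and> S k x \<le> \<tau> \<and> \<tau> < S (Suc k) x}" for \<tau>
  have G_cells: "G \<tau> \<subseteq> cells L" for \<tau> by (auto simp: G_def cells_def)
  have S_cong: "S k x = S k y" if "idx L k x = idx L k y" for k x y
    unfolding S_def using idx_eq_coarser[OF that] by (intro sum.cong) auto
  have S_Suc: "S (Suc k) x = S k x + b k (idx L k x)" for k x by (simp add: S_def)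
  have G_iff: "(k, idx L k x) \<in> G \<tau> \<longleftrightarrow> S k x \<le> \<tau> \<and> \<tau> < S k x + b k (idx L k x)" for k x \<tau>
  proof
    assume "(k, idx L k x) \<in> G \<tau>"
    then obtain y where y: "idx L k y = idx L k x" "S k y \<le> \<tau>" "\<tau> < S k y + b k (idx L k y)"
      by (auto simp: G_def S_Suc)
    then show "S k x \<le> \<tau> \<and> \<tau> < S k x + b k (idx L k x)" using S_cong[OF y(1)] by simp
  qed (auto simp: G_def S_Suc)
  \<comment> \<open>A cell is selected exactly for the thresholds in an interval whose length is its
    weight. Hence integrating the cost over \<tau> returns the weighted sum, each cell counted with
    its weight.\<close>
  have section_eq: "{\<tau>. (k, idx L k x) \<in> G \<tau>} = {S k x..<S k x + b k (idx L k x)}" for k x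
    by (auto simp: G_iff)
  have section_meas: "{\<tau>. c \<in> G \<tau>} \<in> sets borel" "emeasure lborel {\<tau>. c \<in> G \<tau>} = ennreal (b (fst c) (snd c))"
    if "c \<in> cells L" for c
    using that b by (auto simp: cells_def section_eq)
  define cost where "cost \<tau> = (\<integral>\<^sup>+ c. ennreal (a (fst c)) * indicator (G \<tau>) c \<partial>count_space (cells L))" for \<tau>
  have "(\<integral>\<^sup>+ \<tau>. cost \<tau> \<partial>lborel)
      = (\<integral>\<^sup>+ \<tau>. \<integral>\<^sup>+ c. ennreal (a (fst c)) * indicator {\<tau>. c \<in> G \<tau>} \<tau> \<partial>count_space (cells L) \<partial>lborel)"
    unfolding cost_def by (intro nn_integral_cong) (auto split: split_indicator)
  also have "\<dots> = (\<integral>\<^sup>+ c. \<integral>\<^sup>+ \<tau>. ennreal (a (fst c)) * indicator {\<tau>. c \<in> G \<tau>} \<tau> \<partial>lborel \<partial>count_space (cells L))"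
    using section_meas(1) by (intro nn_integral_count_space_nn_integral countable_cells) auto
  also have "\<dots> = (\<integral>\<^sup>+ c. ennreal (b (fst c) (snd c) * a (fst c)) \<partial>count_space (cells L))"
    using section_meas a b
    by (intro nn_integral_cong) (simp add: nn_integral_cmult_indicator ennreal_mult mult.commute)
  finally have total: "(\<integral>\<^sup>+ \<tau>. cost \<tau> \<partial>lborel) \<le> ennreal \<mu>" using sum by simp
  \<comment> \<open>If every threshold in this range cost more than 2\<mu>/\<Lambda>, the integral
    of the cost would be at least 2\<mu>, twice its bound. With the factor 2 a non-strict comparison
    of integrals already contradicts \<mu> > 0.\<close>
  have "\<exists>\<tau>\<in>{0..<\<Lambda>}. cost \<tau> \<le> ennreal (2 * \<mu> / \<Lambda>)"
  proof (rule ccontr)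
    assume "\<not> ?thesis"
    then have "(\<integral>\<^sup>+ \<tau>. ennreal (2 * \<mu> / \<Lambda>) * indicator {0..<\<Lambda>} \<tau> \<partial>lborel) \<le> (\<integral>\<^sup>+ \<tau>. cost \<tau> \<partial>lborel)"
      by (intro nn_integral_mono) (auto split: split_indicator simp: not_le less_imp_le)
    also have "(\<integral>\<^sup>+ \<tau>. ennreal (2 * \<mu> / \<Lambda>) * indicator {0..<\<Lambda>} \<tau> \<partial>lborel) = ennreal (2 * \<mu>)"
      using assms(2,3) by (simp add: nn_integral_cmult_indicator ennreal_mult[symmetric])
    finally have "ennreal (2 * \<mu>) \<le> ennreal \<mu>" using total by (rule order_trans)
    then show False using assms(3) by (simp add: ennreal_le_iff)
  qed
  then obtain \<tau> where \<tau>: "0 \<le> \<tau>" "\<tau> < \<Lambda>" "cost \<tau> \<le> ennreal (2 * \<mu> / \<Lambda>)" by auto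
  have "(\<integral>\<^sup>+ c. ennreal (a (fst c)) \<partial>count_space (G \<tau>)) = (\<integral>\<^sup>+ c. ennreal (a (fst c)) * indicator (G \<tau>) c \<partial>count_space (G \<tau>))"
    by (intro nn_integral_cong) auto
  also have "\<dots> = cost \<tau>"
    unfolding cost_def using G_cells[of \<tau>] by (intro nn_integral_count_space_eq) auto
  finally have "(\<integral>\<^sup>+ c. ennreal (a (fst c)) \<partial>count_space (G \<tau>)) \<le> ennreal (2 * \<mu> / \<Lambda>)" using \<tau>(3) by simp
  moreover have "\<exists>j\<le>k. (j, idx L j x) \<in> G \<tau>" if "S k x > \<Lambda>" for k x
  proof -
    have "\<tau> < S k x" using that \<tau> by simp
    define j where "j = (LEAST j. \<tau> < S j x)"
    have j: "\<tau> < S j x" "j \<le> k" unfolding j_def using \<open>\<tau> < S k x\<close> by (auto intro: LeastI Least_le)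
    \<comment> \<open>The empty sum \<open>S 0 x\<close> is 0 <= \<tau>, so the first index above
      \<tau> has a predecessor, and the jump across \<tau> happens at the cell of that
      generation.\<close>
    have "j \<noteq> 0" using j(1) \<tau>(1) by (auto simp: S_def intro!: Nat.gr0I)
    then obtain i where i: "j = Suc i" by (cases j) auto
    then have "S i x \<le> \<tau>" using not_less_Least[of i "\<lambda>j. \<tau> < S j x"] by (auto simp: j_def)
    then show ?thesis using j i by (intro exI[of _ i]) (auto simp: G_iff S_Suc)
  qed
  ultimately show ?thesis using G_cells[of \<tau>] unfolding S_def by blast
qed

text \<open>A stopping argument: among the cells whose descendants carry too much of w, keep those
  with no heavy cell above them. Their trees of descendants are disjoint and w is additive on the
  tree, so their costs add up; each heavy cell is kept or lies under a kept one.\<close>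

lemma maximal_cells_cover:
  fixes w :: "nat \<times> 'a::euclidean_space \<Rightarrow> ennreal"
  assumes "\<Lambda> > 0" "\<mu> > 0" and sum: "(\<integral>\<^sup>+ c. w c \<partial>count_space (cells L)) \<le> ennreal \<mu>"
    and a: "\<And>k. 0 \<le> a k"
  shows "\<exists>G\<subseteq>cells L. (\<integral>\<^sup>+ c. ennreal (a (fst c)) \<partial>count_space G) \<le> ennreal (\<mu> / \<Lambda>) \<and>
    (\<forall>k x. (\<integral>\<^sup>+ c. w c \<partial>count_space (below L k (idx L k x))) > ennreal (\<Lambda> * a k) \<longrightarrow> (\<exists>j\<le>k. (j, idx L j x) \<in> G))"
proof -
  define H where "H k m \<longleftrightarrow> (\<integral>\<^sup>+ c. w c \<partial>count_space (below L k m)) > ennreal (\<Lambda> * a k)" for k m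
  define G where "G = {(k, m). \<exists>x. idx L k x = m \<and> H k m \<and> (\<forall>j<k. \<not> H j (idx L j x))}"
  have G_cells: "G \<subseteq> cells L" by (auto simp: G_def cells_def)
  \<comment> \<open>Two selected cells with a common descendant lie on one branch, and a branch has
    only one first heavy cell.\<close>
  have uniq: "g = g'" if gG: "g \<in> G" "g' \<in> G" and cb: "c \<in> below L (fst g) (snd g)" "c \<in> below L (fst g') (snd g')" for g g' c
  proof -
    obtain j y where c: "c = (j, idx L j y)" using cb(1) by (auto simp: below_def)
    have y: "fst g \<le> j" "idx L (fst g) y = snd g" "fst g' \<le> j" "idx L (fst g') y = snd g'"
      using cb idx_of_below unfolding c by blast+
    have *: "H (fst h) (idx L (fst h) y) \<and> (\<forall>i<fst h. \<not> H i (idx L i y))" if hG: "h \<in> G" and hy: "idx L (fst h) y = snd h" for h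
    proof -
      obtain x where x: "idx L (fst h) x = snd h" "H (fst h) (snd h)" "\<forall>j<fst h. \<not> H j (idx L j x)"
        using hG by (auto simp: G_def)
      have "idx L i x = idx L i y" if "i < fst h" for i
        using idx_eq_coarser[of L "fst h" x y i] x(1) hy that by simp
      then show ?thesis using x hy by auto
    qed
    have "fst g = fst g'"
      using *[OF gG(1) y(2)] *[OF gG(2) y(4)] by (metis linorder_neqE_nat)
    then show ?thesis using y by (simp add: prod_eq_iff)
  qed
  have "ennreal \<Lambda> * (\<integral>\<^sup>+ g. ennreal (a (fst g)) \<partial>count_space G) = (\<integral>\<^sup>+ g. ennreal (\<Lambda> * a (fst g)) \<partial>count_space G)"
    using assms(1) a by (simp add: nn_integral_cmult[symmetric] ennreal_mult)
  also have "\<dots> \<le> (\<integral>\<^sup>+ g. \<integral>\<^sup>+ c. w c * indicator (below L (fst g) (snd g)) c \<partial>count_space (cells L) \<partial>count_space G)"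
  proof (intro nn_integral_mono)
    fix g assume "g \<in> space (count_space G)"
    then have "H (fst g) (snd g)" by (auto simp: G_def)
    then have "ennreal (\<Lambda> * a (fst g)) \<le> (\<integral>\<^sup>+ c. w c \<partial>count_space (below L (fst g) (snd g)))"
      by (simp add: H_def)
    also have "\<dots> = (\<integral>\<^sup>+ c. w c * indicator (below L (fst g) (snd g)) c \<partial>count_space (below L (fst g) (snd g)))"
      by (intro nn_integral_cong) auto
    also have "\<dots> = (\<integral>\<^sup>+ c. w c * indicator (below L (fst g) (snd g)) c \<partial>count_space (cells L))"
      using below_cells by (intro nn_integral_count_space_eq) auto
    finally show "ennreal (\<Lambda> * a (fst g)) \<le> (\<integral>\<^sup>+ c. w c * indicator (below L (fst g) (snd g)) c \<partial>count_space (cells L))" .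
  qed
  also have "\<dots> = (\<integral>\<^sup>+ c. \<integral>\<^sup>+ g. w c * indicator (below L (fst g) (snd g)) c \<partial>count_space G \<partial>count_space (cells L))"
    by (rule nn_integral_count_space_nn_integral[symmetric])
      (auto intro: countable_subset[OF G_cells countable_cells])
  also have "\<dots> \<le> (\<integral>\<^sup>+ c. w c \<partial>count_space (cells L))"
  proof (intro nn_integral_mono)
    fix c
    show "(\<integral>\<^sup>+ g. w c * indicator (below L (fst g) (snd g)) c \<partial>count_space G) \<le> w c"
    proof (cases "\<exists>g\<in>G. c \<in> below L (fst g) (snd g)")
      case True
      then obtain g where g: "g \<in> G" "c \<in> below L (fst g) (snd g)" by auto
      have "(\<integral>\<^sup>+ g. w c * indicator (below L (fst g) (snd g)) c \<partial>count_space G)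
          = (\<Sum>g\<in>{g}. w c * indicator (below L (fst g) (snd g)) c)"
      proof (rule nn_integral_count_space')
        fix h assume "h \<in> G" "h \<notin> {g}"
        then have "c \<notin> below L (fst h) (snd h)" using uniq[OF g(1) _ g(2)] by blast
        then show "w c * indicator (below L (fst h) (snd h)) c = 0" by simp
      qed (use g in auto)
      then show ?thesis using g by simp
    next
      case False
      then have "(\<integral>\<^sup>+ g. w c * indicator (below L (fst g) (snd g)) c \<partial>count_space G) = (\<integral>\<^sup>+ g. 0 \<partial>count_space G)"
        by (intro nn_integral_cong) auto
      then show ?thesis by simp
    qed
  qed
  also note sum
  finally have "ennreal (1 / \<Lambda>) * (ennreal \<Lambda> * (\<integral>\<^sup>+ g. ennreal (a (fst g)) \<partial>count_space G)) \<le> ennreal (1 / \<Lambda>) * ennreal \<mu>"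
    by (intro mult_left_mono) auto
  then have "(\<integral>\<^sup>+ g. ennreal (a (fst g)) \<partial>count_space G) \<le> ennreal (\<mu> / \<Lambda>)"
    using assms(1,2) by (simp add: mult.assoc[symmetric] ennreal_mult[symmetric])
  moreover have "\<exists>j\<le>k. (j, idx L j x) \<in> G" if "H k (idx L k x)" for k x
  proof -
    define j where "j = (LEAST j. H j (idx L j x))"
    have "H j (idx L j x)" "j \<le> k" unfolding j_def using that by (auto intro: LeastI Least_le)
    moreover have "\<forall>i<j. \<not> H i (idx L i x)" using not_less_Least unfolding j_def by blast
    ultimately show ?thesis by (intro exI[of _ j]) (auto simp: G_def)
  qed
  ultimately show ?thesis using G_cells unfolding H_def by blast
qed

section \<open>Lebesgue mass controlled by the weights\<close>

lemma weights_mass_le: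
  fixes b :: "nat \<Rightarrow> 'a::euclidean_space \<Rightarrow> real"
  assumes "L > 0" "\<delta> > 0" "r \<ge> 1" "r * \<delta> = real DIM('a)" and b: "\<And>k m. 0 \<le> b k m"
    and A: "A \<subseteq> cells L" and T: "T > 0" "(\<integral>\<^sup>+ c. ennreal (b (fst c) (snd c) * side L (fst c) powr \<delta>) \<partial>count_space A) \<le> ennreal T"
  shows "(\<integral>\<^sup>+ y. \<integral>\<^sup>+ c. ennreal (b (fst c) (snd c) powr r) * indicator {y. idx L (fst c) y = snd c} y \<partial>count_space A \<partial>lborel)
    \<le> ennreal (T powr r)"
proof -
  have "countable A" using A countable_cells countable_subset by blast
  then have "(\<integral>\<^sup>+ y. \<integral>\<^sup>+ c. ennreal (b (fst c) (snd c) powr r) * indicator {y. idx L (fst c) y = snd c} y \<partial>count_space A \<partial>lborel)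
      = (\<integral>\<^sup>+ c. \<integral>\<^sup>+ y. ennreal (b (fst c) (snd c) powr r) * indicator {y. idx L (fst c) y = snd c} y \<partial>lborel \<partial>count_space A)"
    by (intro nn_integral_count_space_nn_integral) auto
  also have "\<dots> \<le> (\<integral>\<^sup>+ c. ennreal ((b (fst c) (snd c) * side L (fst c) powr \<delta>) powr r) \<partial>count_space A)"
  proof (intro nn_integral_mono)
    fix c :: "nat \<times> 'a"
    have "(\<integral>\<^sup>+ y. ennreal (b (fst c) (snd c) powr r) * indicator {y. idx L (fst c) y = snd c} y \<partial>lborel)
        \<le> ennreal (b (fst c) (snd c) powr r) * ennreal (side L (fst c) ^ DIM('a))"
      by (subst nn_integral_cmult_indicator) (auto intro!: mult_left_mono emeasure_cell_le assms(1))
    \<comment> \<open>Since r \<delta> = n, the volume of a cell is the r-th power of side^\<delta>.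
      The mass contributed by a cell is therefore at most the r-th power of its cost b *
      side^\<delta>, and the l^1 bound on the costs applies.\<close>
    also have "side L (fst c) ^ DIM('a) = (side L (fst c) powr \<delta>) powr r"
      using side_pos[OF assms(1), of "fst c"] assms(4) by (simp add: powr_powr powr_realpow mult.commute)
    finally show "(\<integral>\<^sup>+ y. ennreal (b (fst c) (snd c) powr r) * indicator {y. idx L (fst c) y = snd c} y \<partial>lborel)
        \<le> ennreal ((b (fst c) (snd c) * side L (fst c) powr \<delta>) powr r)"
      using b[of "fst c" "snd c"] by (simp add: powr_mult ennreal_mult)
  qed
  also have "\<dots> \<le> ennreal (T powr r)"
    using b assms(3) T by (intro nn_integral_powr_le) auto
  finally show ?thesis .
qed

lemma mass_le_total:
  fixes b :: "nat \<Rightarrow> 'a::euclidean_space \<Rightarrow> real" and g :: "'a \<Rightarrow> ennreal"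
  assumes "L > 0" "\<delta> > 0" "r \<ge> 1" "r * \<delta> = real DIM('a)" and b: "\<And>k m. 0 \<le> b k m"
    and T: "T > 0" "(\<integral>\<^sup>+ c. ennreal (b (fst c) (snd c) * side L (fst c) powr \<delta>) \<partial>count_space (cells L)) \<le> ennreal T"
    and g: "\<And>y. \<exists>k. g y \<le> ennreal (b k (idx L k y) powr r)"
  shows "(\<integral>\<^sup>+ y. g y \<partial>lborel) \<le> ennreal (T powr r)"
proof -
  have "(\<integral>\<^sup>+ y. g y \<partial>lborel) \<le> (\<integral>\<^sup>+ y. \<integral>\<^sup>+ c. ennreal (b (fst c) (snd c) powr r) * indicator {y. idx L (fst c) y = snd c} y \<partial>count_space (cells L) \<partial>lborel)"
  proof (intro nn_integral_mono)
    fix y :: 'a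
    obtain k where "g y \<le> ennreal (b k (idx L k y) powr r)" using g by blast
    also have "\<dots> \<le> (\<integral>\<^sup>+ c. ennreal (b (fst c) (snd c) powr r) * indicator {y. idx L (fst c) y = snd c} y \<partial>count_space (cells L))"
      using nn_integral_ge_point[of "(k, idx L k y)" "cells L"
          "\<lambda>c. ennreal (b (fst c) (snd c) powr r) * indicator {y. idx L (fst c) y = snd c} y"]
      by (simp add: cells_def)
    finally show "g y \<le> (\<integral>\<^sup>+ c. ennreal (b (fst c) (snd c) powr r) * indicator {y. idx L (fst c) y = snd c} y \<partial>count_space (cells L))" .
  qed
  also have "\<dots> \<le> ennreal (T powr r)"
    by (intro weights_mass_le[OF assms(1-5) order_refl T])
  finally show ?thesis .
qed

text \<open>The weight dominating g at a point of the cell belongs to a strictly coarser cell or to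
  one in \<open>below\<close>. In the first case it is a summand of the branch sum, so g <=
  \<Lambda>^r; in the second the r-th powers integrate to at most (\<Lambda> * side^\<delta>)^r =
  \<Lambda>^r * side^n. The two cases give the factor 2.\<close>

lemma mass_le_cell:
  fixes b :: "nat \<Rightarrow> 'a::euclidean_space \<Rightarrow> real" and g :: "'a \<Rightarrow> ennreal"
  assumes "L > 0" "\<delta> > 0" "r \<ge> 1" "r * \<delta> = real DIM('a)" and b: "\<And>k m. 0 \<le> b k m"
    and g: "\<And>y. \<exists>k. g y \<le> ennreal (b k (idx L k y) powr r)" and "\<Lambda> > 0"
    and S: "(\<Sum>j<k. b j (idx L j x)) \<le> \<Lambda>"
    and M: "(\<integral>\<^sup>+ c. ennreal (b (fst c) (snd c) * side L (fst c) powr \<delta>) \<partial>count_space (below L k (idx L k x)))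
      \<le> ennreal (\<Lambda> * side L k powr \<delta>)"
  shows "(\<integral>\<^sup>+ y. g y * indicator {y. idx L k y = idx L k x} y \<partial>lborel) \<le> ennreal (2 * \<Lambda> powr r * side L k ^ DIM('a))"
proof -
  define h where "h y = (\<integral>\<^sup>+ c. ennreal (b (fst c) (snd c) powr r) * indicator {y. idx L (fst c) y = snd c} y
    \<partial>count_space (below L k (idx L k x)))" for y
  \<comment> \<open>The cell variable ranges over a countable set, so measurability in y for each
    cell gives joint measurability, and summing over the cells preserves it.\<close>
  have [measurable]: "h \<in> borel_measurable borel"
  proof -
    have cb: "countable (below L k (idx L k x))"
      by (rule countable_subset[OF below_cells countable_cells])
    interpret sigma_finite_measure "count_space (below L k (idx L k x))"
      by (rule sigma_finite_measure_count_space_countable[OF cb])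
    define \<phi> where "\<phi> = (\<lambda>(y, c). ennreal (b (fst c) (snd c) powr r) * indicator {y. idx L (fst c) y = snd c} y)"
    have "(\<lambda>(c, y). \<phi> (y, c)) \<in> borel_measurable (count_space (below L k (idx L k x)) \<Otimes>\<^sub>M borel)"
      unfolding \<phi>_def by (rule measurable_pair_measure_countable1[OF cb]) simp
    then have "\<phi> \<in> borel_measurable (borel \<Otimes>\<^sub>M count_space (below L k (idx L k x)))"
      by (subst measurable_pair_swap_iff)
    then show ?thesis
      using borel_measurable_nn_integral[of "\<lambda>y c. \<phi> (y, c)" borel] unfolding h_def \<phi>_def by simp
  qed
  have "(\<integral>\<^sup>+ y. g y * indicator {y. idx L k y = idx L k x} y \<partial>lborel)
      \<le> (\<integral>\<^sup>+ y. h y + ennreal (\<Lambda> powr r) * indicator {y. idx L k y = idx L k x} y \<partial>lborel)"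
  proof (intro nn_integral_mono)
    fix y :: 'a
    show "g y * indicator {y. idx L k y = idx L k x} y \<le> h y + ennreal (\<Lambda> powr r) * indicator {y. idx L k y = idx L k x} y"
    proof (cases "idx L k y = idx L k x")
      case True
      obtain j where j: "g y \<le> ennreal (b j (idx L j y) powr r)" using g by blast
      show ?thesis
      proof (cases "j < k")
        case True
        then have "b j (idx L j x) \<le> (\<Sum>j<k. b j (idx L j x))"
          using b by (intro member_le_sum) auto
        moreover have "idx L j y = idx L j x"
          using idx_eq_coarser[of L k y x j] \<open>idx L k y = idx L k x\<close> True by simp
        ultimately have "b j (idx L j y) powr r \<le> \<Lambda> powr r"
          using S b assms(3) by (intro powr_mono2) auto
        then have "g y \<le> ennreal (\<Lambda> powr r)" using j by (meson ennreal_leI order_trans)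
        then show ?thesis using \<open>idx L k y = idx L k x\<close> by (simp add: add_increasing)
      next
        case False
        have "(j, idx L j y) \<in> below L k (idx L k x)"
          using idx_in_below[of k j L y] False \<open>idx L k y = idx L k x\<close> by simp
        from nn_integral_ge_point[OF this,
            of "\<lambda>c. ennreal (b (fst c) (snd c) powr r) * indicator {y. idx L (fst c) y = snd c} y"]
        have "g y \<le> h y" unfolding h_def using j by simp
        then show ?thesis by (simp add: add_increasing2 split: split_indicator)
      qed
    qed simp
  qed
  also have "\<dots> = (\<integral>\<^sup>+ y. h y \<partial>lborel) + ennreal (\<Lambda> powr r) * emeasure lborel {y. idx L k y = idx L k x}"
    by (subst nn_integral_add) (auto simp: nn_integral_cmult_indicator)
  also have "\<dots> \<le> ennreal ((\<Lambda> * side L k powr \<delta>) powr r) + ennreal (\<Lambda> powr r) * ennreal (side L k ^ DIM('a))"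
    unfolding h_def using assms(7) side_pos[OF assms(1), of k]
    by (intro add_mono mult_left_mono emeasure_cell_le assms(1) weights_mass_le[OF assms(1-5) below_cells _ M]) auto
  also have "(\<Lambda> * side L k powr \<delta>) powr r = \<Lambda> powr r * side L k ^ DIM('a)"
    using assms(4,7) side_pos[OF assms(1), of k] by (simp add: powr_mult powr_powr powr_realpow mult.commute)
  finally show ?thesis
    using side_pos[OF assms(1), of k]
    by (simp add: ennreal_mult[symmetric] ennreal_plus[symmetric] mult.assoc del: ennreal_plus)
qed

lemma nn_integral_count_space_Un_le:
  fixes h :: "'b \<Rightarrow> ennreal"
  shows "(\<integral>\<^sup>+ y. h y \<partial>count_space (A \<union> B)) \<le> (\<integral>\<^sup>+ y. h y \<partial>count_space A) + (\<integral>\<^sup>+ y. h y \<partial>count_space B)"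
proof -
  have "(\<integral>\<^sup>+ y. h y * indicator (A \<union> B) y \<partial>count_space UNIV)
      \<le> (\<integral>\<^sup>+ y. h y * indicator A y + h y * indicator B y \<partial>count_space UNIV)"
    by (intro nn_integral_mono) (auto split: split_indicator)
  also have "\<dots> = (\<integral>\<^sup>+ y. h y * indicator A y \<partial>count_space UNIV) + (\<integral>\<^sup>+ y. h y * indicator B y \<partial>count_space UNIV)"
    by (intro nn_integral_add) auto
  finally show ?thesis by (simp only: nn_integral_count_space_by_indicator[where f = h])
qed

text \<open>Contrapositive of \<open>mass_le_cell\<close>: a cell with too much mass violates one of
  its two bounds, so it is or lies under a cell of one of the two covers. A ball with too much mass
  is covered by \<open>card nbrs\<close> cells of comparable side, one of which is too heavy;
  enlarging the covering cells absorbs the offset to the centre of the ball.\<close>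

lemma hcontent_maximal_le:
  fixes b :: "nat \<Rightarrow> 'a::euclidean_space \<Rightarrow> real" and g :: "'a \<Rightarrow> ennreal"
  assumes "L > 0" "\<delta> > 0" "\<delta> \<le> real DIM('a)" and b: "\<And>k m. 0 \<le> b k m"
    and diam: "\<And>x y. x \<in> \<Omega> \<Longrightarrow> y \<in> \<Omega> \<Longrightarrow> dist x y < L"
    and g_meas [measurable]: "g \<in> borel_measurable borel" and g_out: "\<And>y. y \<notin> \<Omega> \<Longrightarrow> g y = 0"
    and g: "\<And>y. \<exists>k. g y \<le> ennreal (b k (idx L k y) powr (real DIM('a) / \<delta>))"
    and \<mu>: "\<mu> > 0" "(\<integral>\<^sup>+ c. ennreal (b (fst c) (snd c) * side L (fst c) powr \<delta>) \<partial>count_space (cells L)) \<le> ennreal \<mu>"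
    and "\<theta> > 0"
  shows "hcontent \<delta> {x\<in>\<Omega>. \<exists>R>0. (\<integral>\<^sup>+ y. g y * indicator (ball x R) y \<partial>lborel) > ennreal (\<theta> * R ^ DIM('a))}
    \<le> ennreal (3 * (3 * real DIM('a)) powr \<delta> * (real (card (nbrs :: 'a set)) * 2 ^ (DIM('a) + 1)) powr (\<delta> / real DIM('a))
        * \<mu> * \<theta> powr (- (\<delta> / real DIM('a))))"
proof -
  define n where "n = real DIM('a)"
  define N where "N = real (card (nbrs :: 'a set))"
  define r where "r = n / \<delta>"
  \<comment> \<open>Chosen so that the mass allowed on all neighbours together, N * 2 * \<Lambda>^r
    * side_k^n, equals \<theta> * side_(k+1)^n, which is at most \<theta> * R^n for a radius R >
    side_(k+1).\<close>
  define \<Lambda> where "\<Lambda> = (\<theta> / (N * 2 ^ (DIM('a) + 1))) powr (\<delta> / n)"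
  have n: "n > 0" unfolding n_def by simp
  have N: "N > 0" unfolding N_def using card_nbrs_pos[where ?'a='a] by simp
  have r: "r \<ge> 1" "r * \<delta> = real DIM('a)" using assms(2,3) by (auto simp: r_def n_def)
  have \<Lambda>: "\<Lambda> > 0" unfolding \<Lambda>_def using assms(11) N by simp
  have \<Lambda>r: "\<Lambda> powr r = \<theta> / (N * 2 ^ (DIM('a) + 1))"
    unfolding \<Lambda>_def r_def using assms(2,11) n N by (simp add: powr_powr)
  have gr: "\<exists>k. g y \<le> ennreal (b k (idx L k y) powr r)" for y using g by (simp add: r_def n_def)
  define w where "w c = ennreal (b (fst c) (snd c) * side L (fst c) powr \<delta>)" for c
  obtain G1 where G1: "G1 \<subseteq> cells L" "(\<integral>\<^sup>+ c. ennreal (side L (fst c) powr \<delta>) \<partial>count_space G1) \<le> ennreal (2 * \<mu> / \<Lambda>)"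
    "\<And>k x. (\<Sum>j<k. b j (idx L j x)) > \<Lambda> \<Longrightarrow> (\<exists>j\<le>k. (j, idx L j x) \<in> G1)"
    using threshold_cells_cover[where b=b and a = "\<lambda>k. side L k powr \<delta>" and L=L, OF b \<Lambda> \<mu>] by auto
  obtain G2 where G2: "G2 \<subseteq> cells L" "(\<integral>\<^sup>+ c. ennreal (side L (fst c) powr \<delta>) \<partial>count_space G2) \<le> ennreal (\<mu> / \<Lambda>)"
    "\<And>k x. (\<integral>\<^sup>+ c. w c \<partial>count_space (below L k (idx L k x))) > ennreal (\<Lambda> * side L k powr \<delta>) \<Longrightarrow> (\<exists>j\<le>k. (j, idx L j x) \<in> G2)"
    using maximal_cells_cover[OF \<Lambda> \<mu>(1), where a = "\<lambda>k. side L k powr \<delta>" and L=L and w=w] \<mu>(2) by (auto simp: w_def)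
  define G where "G = G1 \<union> G2"
  define E where "E = {x\<in>\<Omega>. \<exists>R>0. (\<integral>\<^sup>+ y. g y * indicator (ball x R) y \<partial>lborel) > ennreal (\<theta> * R ^ DIM('a))}"
  have heavy: "\<exists>j\<le>k. (j, idx L j x) \<in> G"
    if "(\<integral>\<^sup>+ y. g y * indicator {y. idx L k y = idx L k x} y \<partial>lborel) > ennreal (2 * \<Lambda> powr r * side L k ^ DIM('a))" for k x
  proof -
    have "\<not> ((\<Sum>j<k. b j (idx L j x)) \<le> \<Lambda> \<and> (\<integral>\<^sup>+ c. w c \<partial>count_space (below L k (idx L k x))) \<le> ennreal (\<Lambda> * side L k powr \<delta>))"
      using mass_le_cell[where b=b and g=g and k=k and x=x, OF assms(1,2) r b gr \<Lambda>] that
      unfolding w_def by (meson leD)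
    then show ?thesis using G1(3)[where k=k and x=x] G2(3)[where k=k and x=x] unfolding G_def not_le de_Morgan_conj by blast
  qed
  define ctr where "ctr c = (SOME y. idx L (fst c) y = snd c)" for c :: "nat \<times> 'a"
  have ctr: "idx L j (ctr (j, idx L j x)) = idx L j x" for j and x :: 'a
    unfolding ctr_def by (rule someI2[of _ x]) auto
  have "E \<subseteq> (\<Union>c\<in>G. ball (ctr c) (3 * n * side L (fst c)))"
  proof
    fix x assume "x \<in> E"
    then obtain R0 where R0: "x \<in> \<Omega>" "R0 > 0" "(\<integral>\<^sup>+ y. g y * indicator (ball x R0) y \<partial>lborel) > ennreal (\<theta> * R0 ^ DIM('a))"
      by (auto simp: E_def)
    \<comment> \<open>g vanishes outside \<Omega>, and \<Omega> lies within distance L of x. Cutting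
      the radius at L loses no mass, while the bound \<theta> R^n can only shrink.\<close>
    define R where "R = min R0 L"
    have R: "0 < R" "R \<le> L" using R0 assms(1) by (auto simp: R_def)
    have "ennreal (\<theta> * R ^ DIM('a)) \<le> ennreal (\<theta> * R0 ^ DIM('a))"
      using R assms(11) by (intro ennreal_leI mult_left_mono power_mono) (auto simp: R_def)
    also note R0(3)
    also have "(\<integral>\<^sup>+ y. g y * indicator (ball x R0) y \<partial>lborel) \<le> (\<integral>\<^sup>+ y. g y * indicator (ball x R) y \<partial>lborel)"
    proof (intro nn_integral_mono)
      fix y :: 'a
      show "g y * indicator (ball x R0) y \<le> g y * indicator (ball x R) y"
        using g_out[of y] diam[OF R0(1), of y] by (cases "y \<in> \<Omega>") (auto simp: R_def split: split_indicator)
    qed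
    finally have big: "(\<integral>\<^sup>+ y. g y * indicator (ball x R) y \<partial>lborel) > ennreal (\<theta> * R ^ DIM('a))" .
    obtain k where k: "side L (Suc k) < R" "R \<le> side L k" using side_scale_exists[OF R] by blast
    define x' where "x' v = x + side L k *\<^sub>R v" for v
    have idx': "idx L k (x' v) = idx L k x + v" if "v \<in> nbrs" for v
      unfolding x'_def by (rule idx_add_nbr[OF assms(1) that])
    have "\<exists>v\<in>nbrs. (\<integral>\<^sup>+ y. g y * indicator {y. idx L k y = idx L k (x' v)} y \<partial>lborel) > ennreal (2 * \<Lambda> powr r * side L k ^ DIM('a))"
    proof (rule ccontr)
      assume neg: "\<not> ?thesis"
      have "(\<integral>\<^sup>+ y. g y * indicator (ball x R) y \<partial>lborel)
          \<le> (\<integral>\<^sup>+ y. (\<Sum>v\<in>nbrs. g y * indicator {y. idx L k y = idx L k (x' v)} y) \<partial>lborel)"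
      proof (intro nn_integral_mono)
        fix y :: 'a
        show "g y * indicator (ball x R) y \<le> (\<Sum>v\<in>nbrs. g y * indicator {y. idx L k y = idx L k (x' v)} y)"
        proof (cases "y \<in> ball x R")
          case True
          then have "norm (y - x) \<le> side L k" using k by (simp add: dist_norm norm_minus_commute)
          then have "idx L k y - idx L k x \<in> nbrs"
            using Basis_le_norm[of _ "y - x"] by (intro idx_diff_in_nbrs assms(1)) (meson order_trans)
          then obtain v where v: "v \<in> nbrs" "idx L k y = idx L k x + v" by (metis add_diff_cancel_left' diff_add_cancel add.commute)
          have "g y = g y * indicator {y. idx L k y = idx L k (x' v)} y"
            using idx'[OF v(1)] v(2) by simp
          also have "\<dots> \<le> (\<Sum>v\<in>nbrs. g y * indicator {y. idx L k y = idx L k (x' v)} y)"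
            using v(1) finite_nbrs
            by (intro member_le_sum[where f = "\<lambda>v. g y * indicator {y. idx L k y = idx L k (x' v)} y"]) auto
          finally show ?thesis using True by simp
        qed simp
      qed
      also have "\<dots> = (\<Sum>v\<in>nbrs. \<integral>\<^sup>+ y. g y * indicator {y. idx L k y = idx L k (x' v)} y \<partial>lborel)"
        by (intro nn_integral_sum) auto
      also have "\<dots> \<le> (\<Sum>v\<in>(nbrs :: 'a set). ennreal (2 * \<Lambda> powr r * side L k ^ DIM('a)))"
        using neg by (intro sum_mono) (auto simp: not_less)
      also have "\<dots> = ennreal (N * (2 * \<Lambda> powr r * side L k ^ DIM('a)))"
        using side_pos[OF assms(1), of k] by (simp add: N_def ennreal_mult ennreal_of_nat_eq_real_of_nat)
      also have "N * (2 * \<Lambda> powr r * side L k ^ DIM('a)) = \<theta> * side L (Suc k) ^ DIM('a)"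
        using N by (simp add: \<Lambda>r side_Suc power_divide)
      also have "ennreal \<dots> \<le> ennreal (\<theta> * R ^ DIM('a))"
        using k(1) assms(11) side_pos[OF assms(1), of "Suc k"]
        by (intro ennreal_leI mult_left_mono power_mono) auto
      finally show False using big by (simp add: not_less[symmetric])
    qed
    then obtain v j where v: "v \<in> nbrs" and j: "j \<le> k" "(j, idx L j (x' v)) \<in> G" using heavy by blast
    define c where "c = (j, idx L j (x' v))"
    \<comment> \<open>One n * side accounts for the shift from x to the heavy neighbour, one for the
      diameter of the covering cell; the third makes the inequality strict, as an open ball
      requires.\<close>
    have "norm (x' v - x) \<le> n * side L k"
      unfolding n_def using v side_pos[OF assms(1), of k]
      by (intro norm_le_DIM_mult) (auto simp: x'_def nbrs_iff abs_mult dest!: bspec)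
    also have "\<dots> \<le> n * side L j" using side_antimono[OF assms(1) j(1)] n by simp
    finally have 1: "norm (x' v - x) \<le> n * side L j" .
    have 2: "norm (ctr c - x' v) \<le> n * side L j"
      unfolding n_def c_def by (intro norm_le_DIM_mult idx_eq_inner assms(1) ctr)
    have "dist (ctr c) x \<le> norm (ctr c - x' v) + norm (x' v - x)"
      by (metis dist_norm dist_triangle)
    also have "\<dots> < 3 * n * side L j"
      using 1 2 mult_pos_pos[OF n side_pos[OF assms(1), of j]] by linarith
    finally have "x \<in> ball (ctr c) (3 * n * side L (fst c))" by (simp add: c_def)
    then show "x \<in> (\<Union>c\<in>G. ball (ctr c) (3 * n * side L (fst c)))" using j c_def by blast
  qed
  then have "hcontent \<delta> E \<le> (\<integral>\<^sup>+ c. ennreal ((3 * n * side L (fst c)) powr \<delta>) \<partial>count_space G)"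
    using G1(1) G2(1) n side_pos[OF assms(1)]
    by (intro hcontent_le_cover countable_subset[OF _ countable_cells[of L]]) (auto simp: G_def less_imp_le)
  also have "\<dots> = ennreal ((3 * n) powr \<delta>) * (\<integral>\<^sup>+ c. ennreal (side L (fst c) powr \<delta>) \<partial>count_space G)"
    using n side_pos[OF assms(1)] by (subst nn_integral_cmult[symmetric]) (auto simp: powr_mult ennreal_mult less_imp_le)
  also have "(\<integral>\<^sup>+ c. ennreal (side L (fst c) powr \<delta>) \<partial>count_space G) \<le> ennreal (2 * \<mu> / \<Lambda>) + ennreal (\<mu> / \<Lambda>)"
    unfolding G_def by (rule order_trans[OF nn_integral_count_space_Un_le add_mono[OF G1(2) G2(2)]])
  also have "\<dots> = ennreal (3 * \<mu> / \<Lambda>)"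
    using \<mu> \<Lambda> by (simp add: ennreal_plus[symmetric] add_divide_distrib[symmetric] del: ennreal_plus)
  also have "ennreal ((3 * n) powr \<delta>) * \<dots> = ennreal ((3 * n) powr \<delta> * (3 * \<mu> / \<Lambda>))"
    using \<mu> \<Lambda> by (subst ennreal_mult) auto
  also have "(3 * n) powr \<delta> * (3 * \<mu> / \<Lambda>)
      = 3 * (3 * n) powr \<delta> * (N * 2 ^ (DIM('a) + 1)) powr (\<delta> / n) * \<mu> * \<theta> powr (- (\<delta> / n))"
    unfolding \<Lambda>_def using assms(11) N by (simp add: powr_divide powr_minus field_simps)
  finally show ?thesis unfolding E_def n_def N_def by (simp add: mult_left_mono)
qed

section \<open>Averages over cubes\<close>

text \<open>The image of a piece under f can be an arbitrary set of reals. It is enlarged to the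
  interval from its infimum to its supremum, which is Borel and not longer than c; an infinite c is
  served by the whole line.\<close>

lemma real_small_diameter_cover:
  fixes X :: "real set" and c :: ennreal
  assumes "\<And>x y. x \<in> X \<Longrightarrow> y \<in> X \<Longrightarrow> ennreal \<bar>x - y\<bar> \<le> c"
  shows "\<exists>J\<in>sets borel. X \<subseteq> J \<and> emeasure lborel J \<le> c"
proof (cases "X = {} \<or> c = \<infinity>")
  case True
  then show ?thesis by (elim disjE) (force intro: bexI[of _ "{}"] bexI[of _ UNIV])+
next
  case False
  then obtain d where d: "c = ennreal d" "d \<ge> 0" by (cases c) auto
  have le: "\<bar>x - y\<bar> \<le> d" if "x \<in> X" "y \<in> X" for x y
    using assms[OF that] d by simp
  obtain x0 where x0: "x0 \<in> X" using False by auto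
  have bb: "bdd_below X" "bdd_above X"
    using le[OF x0] by (auto intro!: bdd_belowI[of _ "x0 - d"] bdd_aboveI[of _ "x0 + d"] simp: abs_le_iff)
      (smt (verit))+
  have "Sup X \<le> d + Inf X"
  proof (rule cSup_least)
    fix y assume y: "y \<in> X"
    have "y - d \<le> Inf X" using x0 le[OF y] by (intro cInf_greatest) (auto simp: abs_le_iff algebra_simps)
    then show "y \<le> d + Inf X" by simp
  qed (use x0 in auto)
  moreover have "Inf X \<le> Sup X" using bb x0 by (meson cInf_lower cSup_upper order_trans)
  ultimately have "emeasure lborel {Inf X..Sup X} \<le> c" using d by (simp add: ennreal_leI)
  moreover have "X \<subseteq> {Inf X..Sup X}" using bb by (auto intro: cInf_lower cSup_upper)
  ultimately show ?thesis by (intro bexI[of _ "{Inf X..Sup X}"]) auto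
qed

text \<open>The image of a continuous function is an interval, so its length is at most the sum of the
  oscillations over any countable cover; no ordered chain of pieces is needed.\<close>
lemma continuous_oscillation_sum:
  fixes f :: "real \<Rightarrow> real"
  assumes "continuous_on {a..b} f" "a \<le> b" "countable I" "{a..b} \<subseteq> (\<Union>i\<in>I. A i)"
    and osc: "\<And>i s t. i \<in> I \<Longrightarrow> s \<in> A i \<inter> {a..b} \<Longrightarrow> t \<in> A i \<inter> {a..b} \<Longrightarrow> ennreal \<bar>f s - f t\<bar> \<le> c i"
  shows "ennreal \<bar>f a - f b\<bar> \<le> (\<integral>\<^sup>+ i. c i \<partial>count_space I)"
proof -
  have "\<forall>i\<in>I. \<exists>J\<in>sets borel. f ` (A i \<inter> {a..b}) \<subseteq> J \<and> emeasure lborel J \<le> c i"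
    using osc by (intro ballI real_small_diameter_cover) auto
  then obtain J where J: "\<And>i. i \<in> I \<Longrightarrow> J i \<in> sets borel" "\<And>i. i \<in> I \<Longrightarrow> f ` (A i \<inter> {a..b}) \<subseteq> J i"
    "\<And>i. i \<in> I \<Longrightarrow> emeasure lborel (J i) \<le> c i" by metis
  define K where "K = {min (f a) (f b)..max (f a) (f b)}"
  have "connected (f ` {a..b})" using assms(1) by (intro connected_continuous_image) auto
  then have "K \<subseteq> f ` {a..b}" unfolding K_def using assms(2)
    by (intro connected_contains_Icc) (auto simp: min_def max_def)
  then have K: "K \<subseteq> (\<Union>i\<in>I. J i)" using assms(4) J(2) by blast
  have "ennreal \<bar>f a - f b\<bar> = emeasure lborel K" unfolding K_def by (auto simp: min_def max_def)
  also have "\<dots> = (\<integral>\<^sup>+ x. indicator K x \<partial>lborel)" by (simp add: K_def)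
  also have "\<dots> \<le> (\<integral>\<^sup>+ x. \<integral>\<^sup>+ i. indicator (J i) x \<partial>count_space I \<partial>lborel)"
  proof (intro nn_integral_mono)
    fix x
    show "indicator K x \<le> (\<integral>\<^sup>+ i. indicator (J i) x \<partial>count_space I)"
    proof (cases "x \<in> K")
      case True
      then obtain i where i: "i \<in> I" "x \<in> J i" using K by auto
      then show ?thesis using nn_integral_ge_point[OF i(1), of "\<lambda>i. indicator (J i) x"] True by simp
    qed simp
  qed
  also have "\<dots> = (\<integral>\<^sup>+ i. \<integral>\<^sup>+ x. indicator (J i) x \<partial>lborel \<partial>count_space I)"
    using J(1) by (intro nn_integral_count_space_nn_integral assms(3)) auto
  also have "\<dots> \<le> (\<integral>\<^sup>+ i. c i \<partial>count_space I)"
    using J(1,3) by (intro nn_integral_mono) simp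
  finally show ?thesis .
qed

section \<open>Comparison of averages over nearby cubes\<close>

lemma ennreal_abs_integral_le:
  fixes f :: "'a::euclidean_space \<Rightarrow> real"
  assumes "continuous_on (cbox a b) f"
  shows "ennreal \<bar>integral (cbox a b) f\<bar> \<le> (\<integral>\<^sup>+ x. ennreal \<bar>f x\<bar> * indicator (cbox a b) x \<partial>lborel)"
proof -
  have i: "(\<lambda>x. \<bar>f x\<bar>) integrable_on cbox a b" "f integrable_on cbox a b"
    using assms by (auto intro!: integrable_continuous continuous_intros)
  have "\<bar>integral (cbox a b) f\<bar> \<le> integral (cbox a b) (\<lambda>x. \<bar>f x\<bar>)"
    using integral_norm_bound_integral[OF i(2,1)] by simp
  then have "ennreal \<bar>integral (cbox a b) f\<bar> \<le> ennreal (integral (cbox a b) (\<lambda>x. \<bar>f x\<bar>))"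
    by (rule ennreal_leI)
  also have "\<dots> = (\<integral>\<^sup>+ x. ennreal \<bar>f x\<bar> * indicator (cbox a b) x \<partial>lborel)"
    using i(1) by (intro nn_integral_has_integral_lebesgue'[symmetric] integrable_integral) auto
  finally show ?thesis .
qed

lemma nn_integral_affine:
  fixes f :: "'a::euclidean_space \<Rightarrow> ennreal"
  assumes [measurable]: "f \<in> borel_measurable borel" and "c > 0"
  shows "(\<integral>\<^sup>+ x. f (t + c *\<^sub>R x) \<partial>lborel) = ennreal (1 / c ^ DIM('a)) * (\<integral>\<^sup>+ x. f x \<partial>lborel)"
proof -
  have "(\<integral>\<^sup>+ x. f x \<partial>lborel) = (\<integral>\<^sup>+ x. f x \<partial>density (distr lborel borel (\<lambda>x. t + c *\<^sub>R x)) (\<lambda>_. ennreal (\<bar>c\<bar> ^ DIM('a))))"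
    using lborel_affine[of c t] assms(2) by simp
  also have "\<dots> = ennreal (c ^ DIM('a)) * (\<integral>\<^sup>+ x. f (t + c *\<^sub>R x) \<partial>lborel)"
    using assms(2) by (simp add: nn_integral_density nn_integral_distr nn_integral_cmult)
  finally have "ennreal (1 / c ^ DIM('a)) * (\<integral>\<^sup>+ x. f x \<partial>lborel)
      = ennreal (1 / c ^ DIM('a)) * ennreal (c ^ DIM('a)) * (\<integral>\<^sup>+ x. f (t + c *\<^sub>R x) \<partial>lborel)"
    by (simp add: mult.assoc)
  also have "ennreal (1 / c ^ DIM('a)) * ennreal (c ^ DIM('a)) = 1"
    using assms(2) by (simp add: ennreal_mult[symmetric])
  finally show ?thesis by simp
qed

text \<open>The average over the cube with corner y and side r, pulled back to the unit cube. No
  volume is divided out, so the value at r = 0 is \<open>u y\<close>, and for continuous u the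
  average is continuous in r down to 0.\<close>

definition cube_avg :: "('a::euclidean_space \<Rightarrow> real) \<Rightarrow> 'a \<Rightarrow> real \<Rightarrow> real" where
  "cube_avg u y r = integral (cbox 0 One) (\<lambda>z. u (y + r *\<^sub>R z))"

lemma cube_avg_zero: "cube_avg u y 0 = u y"
  by (simp add: cube_avg_def)

lemma norm_unit_cube_le:
  fixes z :: "'a::euclidean_space"
  assumes "z \<in> cbox 0 One"
  shows "norm z \<le> real DIM('a)"
  using norm_le_DIM_mult[of z 1] assms by (simp add: mem_box)

lemma gradient_mass_measurable:
  fixes Du :: "'a::euclidean_space \<Rightarrow> 'a"
  assumes "open \<Omega>" "continuous_on \<Omega> Du"
  shows "(\<lambda>y. ennreal (norm (Du y)) * indicator \<Omega> y) \<in> borel_measurable borel"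
proof -
  have "(\<lambda>x. indicator \<Omega> x *\<^sub>R norm (Du x)) \<in> borel_measurable borel"
    using assms by (intro borel_measurable_continuous_on_indicator continuous_intros) auto
  then have "(\<lambda>x. ennreal (indicator \<Omega> x *\<^sub>R norm (Du x))) \<in> borel_measurable borel" by measurable
  also have "(\<lambda>x. ennreal (indicator \<Omega> x *\<^sub>R norm (Du x))) = (\<lambda>y. ennreal (norm (Du y)) * indicator \<Omega> y)"
    by (auto split: split_indicator)
  finally show ?thesis .
qed

text \<open>Interpolate linearly between the cubes. The point with cube coordinate z moves with
  velocity y' - y + (r' - r) z, of norm at most D, so the change of u along its path is at most D
  times an integral of |Du|. A is any Borel set containing the intermediate cubes.\<close>

lemma cube_avg_diff_le:
  fixes u :: "'a::euclidean_space \<Rightarrow> real" and Du :: "'a \<Rightarrow> 'a"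
  assumes "open \<Omega>" and der: "\<And>x. x \<in> \<Omega> \<Longrightarrow> GDERIV u x :> Du x" and cont: "continuous_on \<Omega> Du"
    and g: "g = (\<lambda>y. ennreal (norm (Du y)) * indicator \<Omega> y)"
    and A [measurable]: "A \<in> sets borel" and \<rho>: "0 < \<rho>" "\<rho> \<le> r" "\<rho> \<le> r'"
    and seg: "\<And>\<sigma> z. \<sigma> \<in> {0..1} \<Longrightarrow> z \<in> cbox 0 One \<Longrightarrow> (y + \<sigma> *\<^sub>R (y' - y)) + (r + \<sigma> * (r' - r)) *\<^sub>R z \<in> \<Omega> \<inter> A"
    and D: "norm (y' - y) + real DIM('a) * \<bar>r' - r\<bar> \<le> D"
  shows "ennreal \<bar>cube_avg u y' r' - cube_avg u y r\<bar>
    \<le> ennreal (D / \<rho> ^ DIM('a)) * (\<integral>\<^sup>+ w. g w * indicator A w \<partial>lborel)"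
proof -
  define P where "P \<sigma> z = (y + \<sigma> *\<^sub>R (y' - y)) + (r + \<sigma> * (r' - r)) *\<^sub>R z" for \<sigma> z
  define v where "v z = y' - y + (r' - r) *\<^sub>R z" for z
  have D0: "D \<ge> 0" using D by (smt (verit) norm_ge_zero mult_nonneg_nonneg of_nat_0_le_iff abs_ge_zero)
  have P: "P \<sigma> z \<in> \<Omega>" "P \<sigma> z \<in> A" if "\<sigma> \<in> {0..1}" "z \<in> cbox 0 One" for \<sigma> z
    using seg[OF that] by (auto simp: P_def)
  have vD: "norm (v z) \<le> D" if "z \<in> cbox 0 One" for z
  proof -
    have "norm (v z) \<le> norm (y' - y) + norm ((r' - r) *\<^sub>R z)" unfolding v_def by (rule norm_triangle_ineq)
    also have "norm ((r' - r) *\<^sub>R z) \<le> \<bar>r' - r\<bar> * real DIM('a)"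
      using norm_unit_cube_le[OF that] by (simp add: mult_left_mono)
    finally show ?thesis using D by (simp add: mult.commute)
  qed
  have ucont: "continuous_on \<Omega> u"
    using der by (intro continuous_at_imp_continuous_on ballI) (auto simp: gderiv_def intro: has_derivative_continuous)
  have gm [measurable]: "g \<in> borel_measurable borel"
    unfolding g by (rule gradient_mass_measurable[OF assms(1) cont])
  have gP: "g (P \<sigma> z) * indicator A (P \<sigma> z) = ennreal (norm (Du (P \<sigma> z)))" if "\<sigma> \<in> {0..1}" "z \<in> cbox 0 One" for \<sigma> z
    using P[OF that] by (simp add: g)
  have line: "ennreal \<bar>u (P 1 z) - u (P 0 z)\<bar>
      \<le> (\<integral>\<^sup>+ \<sigma>. ennreal D * (g (P \<sigma> z) * indicator A (P \<sigma> z)) * indicator {0..1} \<sigma> \<partial>lborel)" if z: "z \<in> cbox 0 One" for z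
  proof -
    define h where "h \<sigma> = v z \<bullet> Du (P \<sigma> z)" for \<sigma>
    have Pd: "(P' has_derivative (\<lambda>\<tau>. \<tau> *\<^sub>R v z)) (at \<sigma> within {0..1})" if "P' = (\<lambda>\<sigma>. P \<sigma> z)" for P' \<sigma>
      unfolding P_def v_def that by (auto intro!: derivative_eq_intros simp: algebra_simps)
    have Pc: "continuous_on {0..1} (\<lambda>\<sigma>. P \<sigma> z)" unfolding P_def by (intro continuous_intros)
    have hc: "continuous_on {0..1} h" unfolding h_def
      using P(1) z by (intro continuous_intros continuous_on_compose2[OF cont Pc]) auto
    have "((\<lambda>\<sigma>. u (P \<sigma> z)) has_vector_derivative h \<sigma>) (at \<sigma> within {0..1})" if "\<sigma> \<in> {0..1}" for \<sigma>
    proof -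
      have "(u has_derivative (\<lambda>k. k \<bullet> Du (P \<sigma> z))) (at (P \<sigma> z))"
        using der[OF P(1)[OF that z]] by (simp add: gderiv_def)
      from has_derivative_compose[OF Pd[OF refl] this]
      show ?thesis by (simp add: has_vector_derivative_def h_def)
    qed
    then have "(h has_integral (u (P 1 z) - u (P 0 z))) {0..1}"
      by (intro fundamental_theorem_of_calculus) auto
    then have "u (P 1 z) - u (P 0 z) = integral (cbox 0 1) h" by (simp add: integral_unique)
    then have "ennreal \<bar>u (P 1 z) - u (P 0 z)\<bar> \<le> (\<integral>\<^sup>+ \<sigma>. ennreal \<bar>h \<sigma>\<bar> * indicator {0..1} \<sigma> \<partial>lborel)"
      using ennreal_abs_integral_le[of 0 1 h] hc by simp
    also have "\<dots> \<le> (\<integral>\<^sup>+ \<sigma>. ennreal D * (g (P \<sigma> z) * indicator A (P \<sigma> z)) * indicator {0..1} \<sigma> \<partial>lborel)"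
    proof (intro nn_integral_mono)
      fix \<sigma> :: real
      have "\<bar>h \<sigma>\<bar> \<le> D * norm (Du (P \<sigma> z))"
        unfolding h_def using vD[OF z] Cauchy_Schwarz_ineq2[of "v z" "Du (P \<sigma> z)"]
        by (smt (verit) mult_right_mono norm_ge_zero)
      then have "ennreal \<bar>h \<sigma>\<bar> \<le> ennreal D * ennreal (norm (Du (P \<sigma> z)))"
        using D0 by (simp add: ennreal_mult[symmetric] ennreal_leI)
      then show "ennreal \<bar>h \<sigma>\<bar> * indicator {0..1} \<sigma> \<le> ennreal D * (g (P \<sigma> z) * indicator A (P \<sigma> z)) * indicator {0..1} \<sigma>"
        using gP[OF _ z, of \<sigma>] by (cases "\<sigma> \<in> {0..1}") auto
    qed
    finally show ?thesis .
  qed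
  define k where "k = (\<lambda>(z, \<sigma>). ennreal D * (g (P \<sigma> z) * indicator A (P \<sigma> z)) * indicator {0..1} \<sigma> * indicator (cbox 0 One) z)"
  have Pm: "(\<lambda>(z, \<sigma>). P \<sigma> z) \<in> borel_measurable (lborel \<Otimes>\<^sub>M lborel)"
    unfolding P_def split_beta by measurable
  have gA: "(\<lambda>w. g w * indicator A w) \<in> borel_measurable borel" by measurable
  have km: "k \<in> borel_measurable (lborel \<Otimes>\<^sub>M lborel)"
  proof -
    have "(\<lambda>p. (\<lambda>w. g w * indicator A w) ((\<lambda>(z, \<sigma>). P \<sigma> z) p)) \<in> borel_measurable (lborel \<Otimes>\<^sub>M lborel)"
      by (rule measurable_compose[OF Pm gA])
    then have 1: "(\<lambda>p. g (P (snd p) (fst p)) * indicator A (P (snd p) (fst p))) \<in> borel_measurable (lborel \<Otimes>\<^sub>M lborel)"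
      by (simp add: split_beta)
    show ?thesis unfolding k_def split_beta using 1 by measurable
  qed
  have uc: "continuous_on (cbox 0 One) (\<lambda>z. u (P \<sigma> z))" if "\<sigma> \<in> {0..1}" for \<sigma>
    using P(1)[OF that] by (intro continuous_on_compose2[OF ucont]) (auto simp: P_def intro!: continuous_intros)
  have avg: "cube_avg u y' r' = integral (cbox 0 One) (\<lambda>z. u (P 1 z))" "cube_avg u y r = integral (cbox 0 One) (\<lambda>z. u (P 0 z))"
    unfolding cube_avg_def P_def by (simp_all add: algebra_simps)
  have "cube_avg u y' r' - cube_avg u y r = integral (cbox 0 One) (\<lambda>z. u (P 1 z) - u (P 0 z))"
    unfolding avg using uc[of 0] uc[of 1] by (intro integral_diff[symmetric] integrable_continuous) auto
  then have "ennreal \<bar>cube_avg u y' r' - cube_avg u y r\<bar>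
      \<le> (\<integral>\<^sup>+ z. ennreal \<bar>u (P 1 z) - u (P 0 z)\<bar> * indicator (cbox 0 One) z \<partial>lborel)"
    using uc[of 0] uc[of 1] by (auto intro!: ennreal_abs_integral_le continuous_intros)
  also have "\<dots> \<le> (\<integral>\<^sup>+ z. \<integral>\<^sup>+ \<sigma>. k (z, \<sigma>) \<partial>lborel \<partial>lborel)"
  proof (intro nn_integral_mono)
    fix z :: 'a
    show "ennreal \<bar>u (P 1 z) - u (P 0 z)\<bar> * indicator (cbox 0 One) z \<le> (\<integral>\<^sup>+ \<sigma>. k (z, \<sigma>) \<partial>lborel)"
      using line[of z] by (cases "z \<in> cbox 0 One") (auto simp: k_def)
  qed
  \<comment> \<open>With the spatial integral innermost, \<sigma> is fixed and the path map is a
    dilation by a factor of at least \<rho> followed by a translation; the change of variables costs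
    1/\<rho>^n.\<close>
  also have "\<dots> = (\<integral>\<^sup>+ \<sigma>. \<integral>\<^sup>+ z. k (z, \<sigma>) \<partial>lborel \<partial>lborel)"
    by (rule lborel_pair.Fubini[OF km, symmetric])
  also have "\<dots> \<le> (\<integral>\<^sup>+ \<sigma>. ennreal (D / \<rho> ^ DIM('a)) * (\<integral>\<^sup>+ w. g w * indicator A w \<partial>lborel) * indicator {0..1::real} \<sigma> \<partial>lborel)"
  proof (intro nn_integral_mono)
    fix \<sigma> :: real
    show "(\<integral>\<^sup>+ z. k (z, \<sigma>) \<partial>lborel) \<le> ennreal (D / \<rho> ^ DIM('a)) * (\<integral>\<^sup>+ w. g w * indicator A w \<partial>lborel) * indicator {0..1} \<sigma>"
    proof (cases "\<sigma> \<in> {0..1}")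
      case True
      define c where "c = r + \<sigma> * (r' - r)"
      have "c = (1 - \<sigma>) * r + \<sigma> * r'" by (simp add: c_def algebra_simps)
      also have "\<dots> \<ge> (1 - \<sigma>) * \<rho> + \<sigma> * \<rho>" using True \<rho> by (intro add_mono mult_left_mono) auto
      finally have c: "c \<ge> \<rho>" by (simp add: algebra_simps)
      have "(\<integral>\<^sup>+ z. k (z, \<sigma>) \<partial>lborel) \<le> (\<integral>\<^sup>+ z. ennreal D * (g (P \<sigma> z) * indicator A (P \<sigma> z)) \<partial>lborel)"
        unfolding k_def by (intro nn_integral_mono) (auto split: split_indicator)
      also have "\<dots> = ennreal D * (\<integral>\<^sup>+ z. g (P \<sigma> z) * indicator A (P \<sigma> z) \<partial>lborel)"
        by (intro nn_integral_cmult) (auto simp: P_def)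
      also have "(\<integral>\<^sup>+ z. g (P \<sigma> z) * indicator A (P \<sigma> z) \<partial>lborel) = ennreal (1 / c ^ DIM('a)) * (\<integral>\<^sup>+ w. g w * indicator A w \<partial>lborel)"
        unfolding P_def c_def[symmetric] using nn_integral_affine[OF gA, of c "y + \<sigma> *\<^sub>R (y' - y)"] c \<rho> by simp
      also have "\<dots> \<le> ennreal (1 / \<rho> ^ DIM('a)) * (\<integral>\<^sup>+ w. g w * indicator A w \<partial>lborel)"
        using c \<rho> by (intro mult_right_mono ennreal_leI divide_left_mono power_mono) auto
      also have "ennreal D * \<dots> = ennreal (D / \<rho> ^ DIM('a)) * (\<integral>\<^sup>+ w. g w * indicator A w \<partial>lborel)"
        using D0 \<rho> by (simp add: mult.assoc[symmetric] ennreal_mult[symmetric])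
      finally show ?thesis using True by (simp add: mult_left_mono)
    qed (simp add: k_def)
  qed
  also have "\<dots> = ennreal (D / \<rho> ^ DIM('a)) * (\<integral>\<^sup>+ w. g w * indicator A w \<partial>lborel)"
    by (simp add: nn_integral_cmult_indicator)
  finally show ?thesis .
qed

text \<open>A segment from a point of \<Omega> to a point outside crosses the frontier, which is
  then no farther away than the end of the segment.\<close>

lemma in_open_if_near:
  fixes x :: "'a::euclidean_space"
  assumes "x \<in> \<Omega>" "dist x y < infdist x (frontier \<Omega>)"
  shows "y \<in> \<Omega>"
proof (rule ccontr)
  assume "y \<notin> \<Omega>"
  then have "closed_segment x y \<inter> frontier \<Omega> \<noteq> {}"
    using assms(1) by (intro connected_Int_frontier) auto
  then obtain z where z: "z \<in> closed_segment x y" "z \<in> frontier \<Omega>" by auto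
  have "infdist x (frontier \<Omega>) \<le> dist x z" by (rule infdist_le[OF z(2)])
  also have "\<dots> \<le> dist x y" using dist_in_closed_segment[OF z(1)] by (simp add: dist_commute)
  finally show False using assms(2) by simp
qed

section \<open>The potential estimate along John curves\<close>

lemma arclength_param_dist_le:
  assumes "arclength_param \<gamma> l" "0 \<le> a" "a \<le> b" "b \<le> l"
  shows "dist (\<gamma> a) (\<gamma> b) \<le> b - a"
proof -
  \<comment> \<open>The partition with a single step, whose polygonal length is the chord.\<close>
  define p where "p i = (if i = (0::nat) then a else b)" for i
  have "ennreal (dist (\<gamma> a) (\<gamma> b)) \<le> arc_length \<gamma> a b"
    unfolding arc_length_def
    by (rule SUP_upper2[of "(p, 1)"]) (use assms in \<open>auto simp: p_def\<close>)
  also have "\<dots> = ennreal (b - a)" using assms by (simp add: arclength_param_def)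
  finally show ?thesis using assms by (simp add: ennreal_le_iff)
qed

lemma continuous_on_cube_avg:
  fixes u :: "'a::euclidean_space \<Rightarrow> real"
  assumes "continuous_on \<Omega> u" "continuous_on U Y" "continuous_on U \<rho>"
    and "\<And>t z. t \<in> U \<Longrightarrow> z \<in> cbox 0 One \<Longrightarrow> Y t + \<rho> t *\<^sub>R z \<in> \<Omega>"
  shows "continuous_on U (\<lambda>t. cube_avg u (Y t) (\<rho> t))"
  unfolding cube_avg_def
proof (rule integral_continuous_on_param)
  have "continuous_on (U \<times> cbox 0 One) (\<lambda>p. u (Y (fst p) + \<rho> (fst p) *\<^sub>R snd p))"
    by (rule continuous_on_compose2[OF assms(1)])
      (auto intro!: continuous_intros continuous_on_compose2[OF assms(2)] continuous_on_compose2[OF assms(3)] assms(4))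
  then show "continuous_on (U \<times> cbox 0 One) (\<lambda>(t, z). u (Y t + \<rho> t *\<^sub>R z))"
    by (simp add: split_beta)
qed

text \<open>Cells are convex: in every coordinate they are half-open intervals.\<close>

lemma idx_convex_combination:
  assumes "L > 0" "idx L k y = m" "idx L k y' = m" "\<sigma> \<in> {0..1}"
  shows "idx L k (y + \<sigma> *\<^sub>R (y' - y)) = m"
proof -
  have "\<lfloor>(y + \<sigma> *\<^sub>R (y' - y)) \<bullet> i / side L k\<rfloor> = \<lfloor>y \<bullet> i / side L k\<rfloor>" if i: "i \<in> Basis" for i
  proof -
    define a b where "a = y \<bullet> i / side L k" and "b = y' \<bullet> i / side L k"
    have fl: "\<lfloor>b\<rfloor> = \<lfloor>a\<rfloor>" using assms(2,3) i idx_eq_iff[of L k y' y] by (auto simp: a_def b_def)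
    have eq: "(y + \<sigma> *\<^sub>R (y' - y)) \<bullet> i / side L k = (1 - \<sigma>) * a + \<sigma> * b"
      by (simp add: a_def b_def inner_add_left inner_diff_left add_divide_distrib diff_divide_distrib algebra_simps)
    have "min a b \<le> (1 - \<sigma>) * a + \<sigma> * b" "(1 - \<sigma>) * a + \<sigma> * b \<le> max a b"
      using assms(4) convex_bound_le[of a "max a b" b "1 - \<sigma>" \<sigma>] convex_bound_le[of "- a" "- min a b" "- b" "1 - \<sigma>" \<sigma>]
      by auto
    moreover have "of_int \<lfloor>a\<rfloor> \<le> min a b" "max a b < of_int \<lfloor>a\<rfloor> + 1" using fl by linarith+
    ultimately have "of_int \<lfloor>a\<rfloor> \<le> (1 - \<sigma>) * a + \<sigma> * b" "(1 - \<sigma>) * a + \<sigma> * b < of_int \<lfloor>a\<rfloor> + 1" by linarith+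
    then show ?thesis unfolding eq a_def[symmetric] by (rule floor_unique)
  qed
  then have "idx L k (y + \<sigma> *\<^sub>R (y' - y)) = idx L k y" by (simp add: idx_eq_iff)
  then show ?thesis using assms(2) by simp
qed

text \<open>\<open>infdist\<close> to the empty set is 0 by convention, so the frontier must first
  be shown nonempty: \<Omega> is nonempty, and being bounded it is not the whole space.\<close>

lemma infdist_frontier_pos:
  fixes \<Omega> :: "'a::euclidean_space set"
  assumes "open \<Omega>" "bounded \<Omega>" "x \<in> \<Omega>"
  shows "0 < infdist x (frontier \<Omega>)"
proof -
  have "frontier \<Omega> \<noteq> {}"
    using assms not_bounded_UNIV frontier_eq_empty by (metis empty_iff)
  moreover have "x \<notin> frontier \<Omega>" using assms by (simp add: frontier_def interior_open)
  ultimately show ?thesis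
    using in_closed_iff_infdist_zero[OF frontier_closed, of \<Omega> x] infdist_nonneg[of x "frontier \<Omega>"] by linarith
qed

text \<open>Otherwise the point at distance L from x in a coordinate direction would still lie in
  \<Omega>. This keeps the cube sizes within the range of the dyadic sides.\<close>

lemma infdist_frontier_le:
  fixes \<Omega> :: "'a::euclidean_space set"
  assumes "L > 0" "x \<in> \<Omega>" "\<And>x y. x \<in> \<Omega> \<Longrightarrow> y \<in> \<Omega> \<Longrightarrow> dist x y < L"
  shows "infdist x (frontier \<Omega>) \<le> L"
proof (rule ccontr)
  assume far: "\<not> ?thesis"
  obtain e :: 'a where e: "e \<in> Basis" using nonempty_Basis by blast
  have d: "dist x (x + L *\<^sub>R e) = L" using assms(1) e by (simp add: dist_norm)
  have "x + L *\<^sub>R e \<in> \<Omega>" using far d by (intro in_open_if_near[OF assms(2)]) simp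
  from assms(3)[OF assms(2) this] d show False by simp
qed

text \<open>One curve starting at x. The constants built below depend only on the dimension, L,
  \<open>cJ\<close> and s, never on x, u or the curve, as the final constant must.\<close>

locale john_curve =
  fixes \<Omega> :: "'a::euclidean_space set" and n L cJ s l :: real and \<gamma> :: "real \<Rightarrow> 'a" and x :: 'a
    and u :: "'a \<Rightarrow> real" and Du :: "'a \<Rightarrow> 'a"
  assumes n: "n = real DIM('a)" and \<Omega>: "open \<Omega>" "bounded \<Omega>" and L: "L > 0"
    and diam: "\<And>x y. x \<in> \<Omega> \<Longrightarrow> y \<in> \<Omega> \<Longrightarrow> dist x y < L"
    and cJ: "cJ > 0" and s: "s \<ge> 1"
    and \<gamma>: "arclength_param \<gamma> l" "\<gamma> 0 = x"
    and \<gamma>_in: "\<And>t. t \<in> {0..l} \<Longrightarrow> \<gamma> t \<in> \<Omega>"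
    and \<gamma>_dist: "\<And>t. t \<in> {0..l} \<Longrightarrow> infdist (\<gamma> t) (frontier \<Omega>) \<ge> cJ * t powr s"
    and der: "\<And>x. x \<in> \<Omega> \<Longrightarrow> GDERIV u x :> Du x" and Du: "continuous_on \<Omega> Du"
begin

abbreviation d :: "'a \<Rightarrow> real" where "d y \<equiv> infdist y (frontier \<Omega>)"

text \<open>With the divisor 6 n a cube of side \<open>rad y\<close> reaches at most d/6 away from
  its corner y. Moreover \<open>rad y\<close> >= side/2 forces d >= 3 n side, more than the 2 n side
  spent when interpolating between cubes of one piece.\<close>

definition rad :: "'a \<Rightarrow> real" where "rad y = d y / (6 * n)"

definition mass :: "'a \<Rightarrow> ennreal" where "mass y = ennreal (norm (Du y)) * indicator \<Omega> y"

text \<open>The first summand comes from solving cJ * t^s <= 6 n side for t; the second turns (2 n +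
  1) side into a multiple of side^(1/s), using side <= L and s >= 1.\<close>

definition ball_const :: real where
  "ball_const = (6 * n / cJ) powr (1 / s) + (2 * n + 1) * L powr (1 - 1 / s)"

definition ball_rad :: "nat \<Rightarrow> real" where "ball_rad k = ball_const * side L k powr (1 / s)"

definition ball_mass :: "nat \<Rightarrow> ennreal" where
  "ball_mass k = (\<integral>\<^sup>+ w. mass w * indicator (ball x (ball_rad k)) w \<partial>lborel)"

lemma n_pos: "n \<ge> 1"
  using DIM_positive[where 'a='a] unfolding n by linarith

lemma l_nonneg: "l \<ge> 0"
  using \<gamma>(1) by (simp add: arclength_param_def)

lemma x_in: "x \<in> \<Omega>"
  using \<gamma>_in[of 0] \<gamma>(2) l_nonneg by simp

lemma mass_measurable [measurable]: "mass \<in> borel_measurable borel"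
  unfolding mass_def[abs_def] by (rule gradient_mass_measurable[OF \<Omega>(1) Du])

lemma u_continuous: "continuous_on \<Omega> u"
  using der by (intro continuous_at_imp_continuous_on ballI) (auto simp: gderiv_def intro: has_derivative_continuous)

lemma side_le_ball_rad: "(6 * n / cJ) powr (1 / s) * side L k powr (1 / s) + (2 * n + 1) * side L k \<le> ball_rad k"
proof -
  have sp: "side L k > 0" by (rule side_pos[OF L])
  have "side L k = side L k powr (1 - 1 / s) * side L k powr (1 / s)"
    using sp by (simp add: powr_add[symmetric])
  also have "\<dots> \<le> L powr (1 - 1 / s) * side L k powr (1 / s)"
    using sp s side_antimono[OF L, of 0 k] by (intro mult_right_mono powr_mono2) (auto simp: side_def)
  finally have "(2 * n + 1) * side L k \<le> (2 * n + 1) * (L powr (1 - 1 / s) * side L k powr (1 / s))"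
    using n_pos by (intro mult_left_mono) auto
  then show ?thesis unfolding ball_rad_def ball_const_def by (simp add: algebra_simps)
qed

lemma cube_in:
  assumes "y \<in> \<Omega>" "0 \<le> r" "r \<le> rad y" "z \<in> cbox 0 One"
  shows "y + r *\<^sub>R z \<in> \<Omega>"
proof (rule in_open_if_near[OF assms(1)])
  have "dist y (y + r *\<^sub>R z) = r * norm z" using assms by (simp add: dist_norm)
  also have "\<dots> \<le> rad y * n" using assms norm_unit_cube_le[OF assms(4)] n by (intro mult_mono) auto
  also have "\<dots> = d y / 6" using n_pos by (simp add: rad_def)
  also have "\<dots> < d y" using infdist_frontier_pos[OF \<Omega> assms(1)] by simp
  finally show "dist y (y + r *\<^sub>R z) < d y" .
qed

lemma rad_bounds:
  assumes "y \<in> \<Omega>"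
  shows "0 < rad y" "rad y \<le> L"
proof -
  show "0 < rad y" using infdist_frontier_pos[OF \<Omega> assms] n_pos by (simp add: rad_def)
  have "rad y \<le> d y / 1" unfolding rad_def using n_pos infdist_nonneg[of y "frontier \<Omega>"] by (intro divide_left_mono) auto
  then show "rad y \<le> L" using infdist_frontier_le[OF L assms diam] by simp
qed

text \<open>With the corner fixed at x the side of the cube shrinks from \<open>rad x\<close> to 0,
  where the average becomes u x. The range of sides is cut into dyadic intervals, and
  \<open>cube_avg_diff_le\<close> bounds the oscillation on each.\<close>

lemma avg_to_center_le:
  "ennreal \<bar>u x - cube_avg u x (rad x)\<bar>
    \<le> (\<integral>\<^sup>+ k. ennreal (n * side L k / side L (Suc k) ^ DIM('a)) * ball_mass k \<partial>count_space UNIV)"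
proof -
  \<comment> \<open>No dyadic interval contains the side 0, so index 0 is reserved for it at cost 0
    and generation k moves to index Suc k.\<close>
  define A where "A k = (case k of 0 \<Rightarrow> {0} | Suc k \<Rightarrow> {side L (Suc k)..side L k})" for k
  define c where "c k = (case k of 0 \<Rightarrow> 0 | Suc k \<Rightarrow> ennreal (n * side L k / side L (Suc k) ^ DIM('a)) * ball_mass k)" for k
  have r: "0 < rad x" "rad x \<le> L" using rad_bounds[OF x_in] by auto
  have "ennreal \<bar>cube_avg u x 0 - cube_avg u x (rad x)\<bar> \<le> (\<integral>\<^sup>+ k. c k \<partial>count_space ({0} \<union> range Suc))"
  proof (rule continuous_oscillation_sum[where A = A and f = "cube_avg u x"])
    show "continuous_on {0..rad x} (cube_avg u x)"
      using cube_in[OF x_in] by (intro continuous_on_cube_avg[OF u_continuous] continuous_intros) auto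
    show "{0..rad x} \<subseteq> (\<Union>i\<in>{0} \<union> range Suc. A i)"
    proof
      fix t assume t: "t \<in> {0..rad x}"
      show "t \<in> (\<Union>i\<in>{0} \<union> range Suc. A i)"
      proof (cases "t = 0")
        case False
        then obtain k where "side L (Suc k) < t" "t \<le> side L k" using side_scale_exists[of t L] t r by auto
        then have "t \<in> A (Suc k)" by (simp add: A_def)
        then show ?thesis by blast
      qed (auto simp: A_def)
    qed
    fix i t t' assume "i \<in> {0} \<union> range Suc" and t: "t \<in> A i \<inter> {0..rad x}" "t' \<in> A i \<inter> {0..rad x}"
    show "ennreal \<bar>cube_avg u x t - cube_avg u x t'\<bar> \<le> c i"
    proof (cases i)
      case 0
      then show ?thesis using t by (simp add: A_def c_def)
    next
      case (Suc k)
      have t1: "side L (Suc k) \<le> t" "t \<le> side L k" "side L (Suc k) \<le> t'" "t' \<le> side L k"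
        using t Suc by (auto simp: A_def)
      have sp: "side L k > 0" "side L (Suc k) > 0" by (rule side_pos[OF L])+
      have "ennreal \<bar>cube_avg u x t - cube_avg u x t'\<bar>
          \<le> ennreal (n * side L k / side L (Suc k) ^ DIM('a)) * (\<integral>\<^sup>+ w. mass w * indicator (ball x (ball_rad k)) w \<partial>lborel)"
      proof (rule cube_avg_diff_le[OF \<Omega>(1) der Du, where g = mass and r = t' and y = x])
        show "mass = (\<lambda>y. ennreal (norm (Du y)) * indicator \<Omega> y)" by (simp add: mass_def[abs_def])
        show "norm (x - x) + real DIM('a) * \<bar>t - t'\<bar> \<le> n * side L k"
          using t1 sp n_pos unfolding n[symmetric] by (auto intro!: mult_left_mono)
        fix \<sigma> :: real and z :: 'a assume \<sigma>: "\<sigma> \<in> {0..1}" and z: "z \<in> cbox 0 One"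
        define r where "r = t' + \<sigma> * (t - t')"
        have "r = (1 - \<sigma>) * t' + \<sigma> * t" by (simp add: r_def algebra_simps)
        then have rb: "0 \<le> r" "r \<le> rad x" "r \<le> side L k"
          using \<sigma> t t1 sp convex_bound_le[of t' "rad x" t "1 - \<sigma>" \<sigma>] convex_bound_le[of t' "side L k" t "1 - \<sigma>" \<sigma>]
          by auto
        have "norm (r *\<^sub>R z) \<le> side L k * n"
          using rb norm_unit_cube_le[OF z] n by (simp add: mult_mono)
        also have "\<dots> < (2 * n + 1) * side L k"
        proof -
          have "side L k * n > 0" using sp(1) n_pos by (intro mult_pos_pos) auto
          then show ?thesis using sp(1) by (simp add: algebra_simps)
        qed
        also have "\<dots> \<le> ball_rad k" using side_le_ball_rad[of k] by (smt (verit) mult_nonneg_nonneg powr_ge_zero)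
        finally have "x + r *\<^sub>R z \<in> ball x (ball_rad k)" by (simp add: dist_norm)
        then show "x + \<sigma> *\<^sub>R (x - x) + (t' + \<sigma> * (t - t')) *\<^sub>R z \<in> \<Omega> \<inter> ball x (ball_rad k)"
          using cube_in[OF x_in rb(1,2) z] by (simp add: r_def)
      qed (use t1 sp in auto)
      then show ?thesis by (simp add: c_def Suc ball_mass_def)
    qed
  qed (use r in auto)
  also have "\<dots> \<le> (\<integral>\<^sup>+ k. c k \<partial>count_space {0}) + (\<integral>\<^sup>+ k. c k \<partial>count_space (range Suc))"
    by (rule nn_integral_count_space_Un_le)
  also have "(\<integral>\<^sup>+ k. c k \<partial>count_space {0}) = 0"
    by (simp add: nn_integral_count_space_finite c_def)
  also have "0 + (\<integral>\<^sup>+ k. c k \<partial>count_space (range Suc)) \<le> (\<integral>\<^sup>+ k. c (Suc k) \<partial>count_space UNIV)"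
    using nn_integral_count_space_image_le[where h = c and \<phi> = Suc and A = UNIV] by simp
  finally show ?thesis by (simp add: cube_avg_zero c_def)
qed

text \<open>The times at which the curve is in a given cell while its cube has size comparable to
  that cell. A piece may be disconnected, since the curve can return; only the oscillation over it
  matters.\<close>

definition piece :: "nat \<times> 'a \<Rightarrow> real set" where
  "piece c = {t\<in>{0..l}. idx L (fst c) (\<gamma> t) = snd c \<and> side L (Suc (fst c)) \<le> rad (\<gamma> t) \<and> rad (\<gamma> t) \<le> side L (fst c)}"

lemma curve_continuous: "continuous_on {0..l} \<gamma>"
proof (rule lipschitz_on_continuous_on)
  show "1-lipschitz_on {0..l} \<gamma>"
  proof (rule lipschitz_onI)
    fix a b assume ab: "a \<in> {0..l}" "b \<in> {0..l}"
    show "dist (\<gamma> a) (\<gamma> b) \<le> 1 * dist a b"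
      using arclength_param_dist_le[OF \<gamma>(1), of a b] arclength_param_dist_le[OF \<gamma>(1), of b a] ab
      by (cases "a \<le> b") (auto simp: dist_real_def dist_commute)
  qed simp
qed

text \<open>Corners in the same cell differ by at most n * side, and the change of size adds at most
  n * side: hence the factor 2 n. The intermediate corners stay in the cell by convexity, so the
  intermediate cubes stay in its neighbours.\<close>

lemma piece_oscillation:
  assumes t: "t \<in> piece (k, m)" "t' \<in> piece (k, m)"
  shows "ennreal \<bar>cube_avg u (\<gamma> t) (rad (\<gamma> t)) - cube_avg u (\<gamma> t') (rad (\<gamma> t'))\<bar>
    \<le> ennreal (2 * n * side L k / side L (Suc k) ^ DIM('a)) * (\<integral>\<^sup>+ w. mass w * indicator {w. idx L k w - m \<in> nbrs} w \<partial>lborel)"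
proof -
  have sp: "side L k > 0" "side L (Suc k) > 0" by (rule side_pos[OF L])+
  define y y' r r' where "y = \<gamma> t'" and "y' = \<gamma> t" and "r = rad y" and "r' = rad y'"
  have y: "y \<in> \<Omega>" "idx L k y = m" "side L (Suc k) \<le> r" "r \<le> side L k"
    and y': "y' \<in> \<Omega>" "idx L k y' = m" "side L (Suc k) \<le> r'" "r' \<le> side L k"
    using t \<gamma>_in by (auto simp: piece_def y_def y'_def r_def r'_def)
  have "\<bar>(y' - y) \<bullet> i\<bar> \<le> side L k" if "i \<in> Basis" for i
    using y(2) y'(2) that by (intro idx_eq_inner[OF L]) auto
  then have yy: "norm (y' - y) \<le> n * side L k" unfolding n by (rule norm_le_DIM_mult)
  have "ennreal \<bar>cube_avg u y' r' - cube_avg u y r\<bar>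
    \<le> ennreal (2 * n * side L k / side L (Suc k) ^ DIM('a)) * (\<integral>\<^sup>+ w. mass w * indicator {w. idx L k w - m \<in> nbrs} w \<partial>lborel)"
  proof (rule cube_avg_diff_le[OF \<Omega>(1) der Du])
    show "mass = (\<lambda>y. ennreal (norm (Du y)) * indicator \<Omega> y)" by (simp add: mass_def[abs_def])
    have "nbrs \<in> sets (borel :: 'a measure)" by (intro borel_closed finite_imp_closed finite_nbrs)
    then show "{w. idx L k w - m \<in> nbrs} \<in> sets borel" by measurable
    have "n * \<bar>r' - r\<bar> \<le> n * side L k" using y y' sp n_pos by (intro mult_left_mono) auto
    then show "norm (y' - y) + real DIM('a) * \<bar>r' - r\<bar> \<le> 2 * n * side L k" using yy unfolding n[symmetric] by linarith
    fix \<sigma> :: real and z :: 'a assume \<sigma>: "\<sigma> \<in> {0..1}" and z: "z \<in> cbox 0 One"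
    define p where "p = y + \<sigma> *\<^sub>R (y' - y)"
    define q where "q = r + \<sigma> * (r' - r)"
    have "q = (1 - \<sigma>) * r + \<sigma> * r'" by (simp add: q_def algebra_simps)
    moreover have "0 \<le> r" "0 \<le> r'" using y(3) y'(3) sp by linarith+
    ultimately have q: "0 \<le> q" "q \<le> side L k"
      using \<sigma> y y' convex_bound_le[of r "side L k" r' "1 - \<sigma>" \<sigma>] by auto
    have "idx L k (p + q *\<^sub>R z) - idx L k p \<in> nbrs"
    proof (rule idx_diff_in_nbrs[OF L])
      fix i :: 'a assume i: "i \<in> Basis"
      have "0 \<le> z \<bullet> i" "z \<bullet> i \<le> 1" using z i by (auto simp: mem_box)
      then show "\<bar>(p + q *\<^sub>R z - p) \<bullet> i\<bar> \<le> side L k"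
        using q mult_mono[of q "side L k" "z \<bullet> i" 1] by (simp add: abs_mult)
    qed
    then have "idx L k (p + q *\<^sub>R z) - m \<in> nbrs"
      unfolding p_def using idx_convex_combination[OF L y(2) y'(2) \<sigma>] by simp
    moreover have "p + q *\<^sub>R z \<in> \<Omega>"
    proof (rule in_open_if_near[OF y(1)])
      have "dist y (p + q *\<^sub>R z) = norm (\<sigma> *\<^sub>R (y' - y) + q *\<^sub>R z)"
        unfolding dist_norm p_def by (subst norm_minus_commute) (simp add: add.commute)
      also have "\<dots> \<le> norm (\<sigma> *\<^sub>R (y' - y)) + norm (q *\<^sub>R z)" by (rule norm_triangle_ineq)
      also have "norm (\<sigma> *\<^sub>R (y' - y)) \<le> 1 * (n * side L k)"
        using yy \<sigma> by (simp only: norm_scaleR, intro mult_mono) auto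
      also have "norm (q *\<^sub>R z) \<le> side L k * n"
        using q norm_unit_cube_le[OF z] n by (simp only: norm_scaleR, intro mult_mono) auto
      finally have "dist y (p + q *\<^sub>R z) \<le> 2 * (n * side L k)" by (simp add: mult.commute)
      also have "\<dots> < 3 * (n * side L k)" using n_pos sp by simp
      also have "\<dots> \<le> infdist y (frontier \<Omega>)"
        using y(3) n_pos unfolding r_def rad_def side_Suc by (simp add: field_simps)
      finally show "dist y (p + q *\<^sub>R z) < infdist y (frontier \<Omega>)" .
    qed
    ultimately show "y + \<sigma> *\<^sub>R (y' - y) + (r + \<sigma> * (r' - r)) *\<^sub>R z \<in> \<Omega> \<inter> {w. idx L k w - m \<in> nbrs}"
      by (simp add: p_def q_def)
  qed (use y y' sp in auto)
  then show ?thesis by (simp add: y_def y'_def r_def r'_def)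
qed

text \<open>The John condition read backwards: a small cube means a near boundary, hence t at most a
  multiple of side^(1/s), and in time t the curve moves at most t away from x. Passing to a
  neighbouring cell adds 2 n side.\<close>

lemma near_piece_in_ball:
  assumes "t \<in> piece (k, m)" "idx L k w - m \<in> nbrs"
  shows "w \<in> ball x (ball_rad k)"
proof -
  have sp: "side L k > 0" by (rule side_pos[OF L])
  have t: "0 \<le> t" "t \<le> l" "idx L k (\<gamma> t) = m" "rad (\<gamma> t) \<le> side L k"
    using assms(1) by (auto simp: piece_def)
  have "cJ * t powr s \<le> d (\<gamma> t)" using \<gamma>_dist[of t] t by simp
  also have "\<dots> \<le> 6 * n * side L k" using t(4) n_pos unfolding rad_def by (simp add: field_simps)
  finally have "t powr s \<le> 6 * n / cJ * side L k" using cJ by (simp add: field_simps)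
  then have "(t powr s) powr (1 / s) \<le> (6 * n / cJ * side L k) powr (1 / s)"
    using s by (intro powr_mono2) auto
  also have "(t powr s) powr (1 / s) = t" using t(1) s by (simp add: powr_powr)
  also have "(6 * n / cJ * side L k) powr (1 / s) = (6 * n / cJ) powr (1 / s) * side L k powr (1 / s)"
    by (rule powr_mult)
  finally have 1: "t \<le> (6 * n / cJ) powr (1 / s) * side L k powr (1 / s)" .
  have 2: "dist x (\<gamma> t) \<le> t" using arclength_param_dist_le[OF \<gamma>(1), of 0 t] t \<gamma>(2) by simp
  have "\<bar>(w - \<gamma> t) \<bullet> i\<bar> \<le> 2 * side L k" if "i \<in> Basis" for i
    using assms(2) t(3) that by (intro idx_diff_nbrs_inner[OF L]) auto
  then have "norm (w - \<gamma> t) \<le> n * (2 * side L k)" unfolding n by (rule norm_le_DIM_mult)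
  then have 3: "dist (\<gamma> t) w \<le> 2 * n * side L k" by (simp add: dist_norm norm_minus_commute mult_ac)
  have "dist x w \<le> dist x (\<gamma> t) + dist (\<gamma> t) w" by (rule dist_triangle)
  also have "\<dots> < (6 * n / cJ) powr (1 / s) * side L k powr (1 / s) + (2 * n + 1) * side L k"
    using 1 2 3 sp by (simp add: distrib_right)
  also have "\<dots> \<le> ball_rad k" by (rule side_le_ball_rad)
  finally show ?thesis by simp
qed

text \<open>The sum over cells is organised by generation. At one generation the neighbourhoods of
  the cells overlap at most \<open>card nbrs\<close> times, and those of visited cells all lie in
  the ball around x, so the sum of their masses is at most \<open>card nbrs\<close> times
  \<open>ball_mass k\<close>.\<close>

lemma avg_along_curve_le:
  "ennreal \<bar>cube_avg u x (rad x) - cube_avg u (\<gamma> l) (rad (\<gamma> l))\<bar>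
    \<le> (\<integral>\<^sup>+ k. ennreal (2 * n * side L k / side L (Suc k) ^ DIM('a)) * (of_nat (card (nbrs :: 'a set)) * ball_mass k) \<partial>count_space UNIV)"
proof -
  \<comment> \<open>Made empty when the piece is empty: such cells cost nothing, and every nonempty
    \<open>near k m\<close> lies in the ball.\<close>
  define near where "near k m = {w. piece (k, m) \<noteq> {} \<and> idx L k w - m \<in> nbrs}" for k m
  have nb: "nbrs \<in> sets (borel :: 'a measure)" by (intro borel_closed finite_imp_closed finite_nbrs)
  have near_meas [measurable]: "near k m \<in> sets borel" for k m
    unfolding near_def using nb by measurable
  define f where "f t = cube_avg u (\<gamma> t) (rad (\<gamma> t))" for t
  define c where "c p = ennreal (2 * n * side L (fst p) / side L (Suc (fst p)) ^ DIM('a)) *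
    (\<integral>\<^sup>+ w. mass w * indicator (near (fst p) (snd p)) w \<partial>lborel)" for p
  have "ennreal \<bar>f 0 - f l\<bar> \<le> (\<integral>\<^sup>+ p. c p \<partial>count_space (cells L))"
  proof (rule continuous_oscillation_sum[where A = piece and f = f])
    show "continuous_on {0..l} f"
      unfolding f_def
    proof (rule continuous_on_cube_avg[OF u_continuous curve_continuous])
      show "continuous_on {0..l} (\<lambda>t. rad (\<gamma> t))"
        unfolding rad_def using n_pos by (intro continuous_intros curve_continuous) auto
      fix t and z :: 'a assume "t \<in> {0..l}" "z \<in> cbox 0 One"
      then show "\<gamma> t + rad (\<gamma> t) *\<^sub>R z \<in> \<Omega>"
        using cube_in[of "\<gamma> t" "rad (\<gamma> t)" z] \<gamma>_in[of t] rad_bounds(1)[of "\<gamma> t"] by auto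
    qed
    show "{0..l} \<subseteq> (\<Union>i\<in>cells L. piece i)"
    proof
      fix t assume t: "t \<in> {0..l}"
      obtain k where k: "side L (Suc k) < rad (\<gamma> t)" "rad (\<gamma> t) \<le> side L k"
        using side_scale_exists[OF rad_bounds[OF \<gamma>_in[OF t]]] by blast
      then have "t \<in> piece (k, idx L k (\<gamma> t))" using t by (simp add: piece_def)
      then show "t \<in> (\<Union>i\<in>cells L. piece i)" by (auto simp: cells_def)
    qed
    fix i t t' assume t: "t \<in> piece i \<inter> {0..l}" "t' \<in> piece i \<inter> {0..l}"
    obtain k m where i: "i = (k, m)" by (cases i)
    have "near k m = {w. idx L k w - m \<in> nbrs}" using t i by (auto simp: near_def)
    then show "ennreal \<bar>f t - f t'\<bar> \<le> c i"
      using piece_oscillation[of t k m t'] t unfolding f_def c_def i by simp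
  qed (use l_nonneg countable_cells in auto)
  also have "\<dots> = (\<integral>\<^sup>+ k. \<integral>\<^sup>+ m. c (k, m) \<partial>count_space (range (idx L k)) \<partial>count_space UNIV)"
    unfolding cells_def by (rule nn_integral_count_space_Sigma)
  also have "\<dots> \<le> (\<integral>\<^sup>+ k. ennreal (2 * n * side L k / side L (Suc k) ^ DIM('a)) * (of_nat (card (nbrs :: 'a set)) * ball_mass k) \<partial>count_space UNIV)"
  proof (intro nn_integral_mono)
    fix k :: nat
    have cnt: "countable (range (idx L k :: 'a \<Rightarrow> 'a))"
      by (rule countable_subset[OF _ countable_image[OF countable_cells[of L], of snd]]) (force simp: cells_def)
    have "(\<integral>\<^sup>+ m. c (k, m) \<partial>count_space (range (idx L k)))
        = ennreal (2 * n * side L k / side L (Suc k) ^ DIM('a)) *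
          (\<integral>\<^sup>+ m. \<integral>\<^sup>+ w. mass w * indicator (near k m) w \<partial>lborel \<partial>count_space (range (idx L k)))"
      unfolding c_def by (simp add: nn_integral_cmult)
    also have "(\<integral>\<^sup>+ m. \<integral>\<^sup>+ w. mass w * indicator (near k m) w \<partial>lborel \<partial>count_space (range (idx L k)))
        = (\<integral>\<^sup>+ w. \<integral>\<^sup>+ m. mass w * indicator (near k m) w \<partial>count_space (range (idx L k)) \<partial>lborel)"
      by (rule nn_integral_count_space_nn_integral[symmetric, OF cnt]) auto
    also have "\<dots> \<le> (\<integral>\<^sup>+ w. of_nat (card (nbrs :: 'a set)) * (mass w * indicator (ball x (ball_rad k)) w) \<partial>lborel)"
    proof (intro nn_integral_mono)
      fix w :: 'a
      \<comment> \<open>Contains every label m for which w is near the cell m, whence the overlap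
        bound.\<close>
      define M where "M = (\<lambda>v. idx L k w - v) ` nbrs"
      have M: "finite M" "card M \<le> card (nbrs :: 'a set)"
        unfolding M_def using finite_nbrs card_image_le by auto
      have "(\<integral>\<^sup>+ m. mass w * indicator (near k m) w \<partial>count_space (range (idx L k)))
          \<le> (\<integral>\<^sup>+ m. mass w * indicator (ball x (ball_rad k)) w * indicator M m \<partial>count_space UNIV)"
        unfolding nn_integral_count_space_by_indicator[where X = "range (idx L k)"]
      proof (intro nn_integral_mono)
        fix m :: 'a
        have "w \<in> ball x (ball_rad k) \<and> m \<in> M" if "w \<in> near k m"
        proof
          show "w \<in> ball x (ball_rad k)" using that near_piece_in_ball unfolding near_def by auto
          show "m \<in> M" unfolding M_def by (rule image_eqI[of _ _ "idx L k w - m"]) (use that in \<open>auto simp: near_def\<close>)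
        qed
        then show "mass w * indicator (near k m) w * indicator (range (idx L k)) m
          \<le> mass w * indicator (ball x (ball_rad k)) w * indicator M m"
          by (auto split: split_indicator)
      qed
      also have "\<dots> = mass w * indicator (ball x (ball_rad k)) w * of_nat (card M)"
        using M(1) by (simp add: nn_integral_cmult_indicator)
      also have "\<dots> \<le> of_nat (card (nbrs :: 'a set)) * (mass w * indicator (ball x (ball_rad k)) w)"
        using M(2) by (subst mult.commute) (intro mult_right_mono, auto)
      finally show "(\<integral>\<^sup>+ m. mass w * indicator (near k m) w \<partial>count_space (range (idx L k)))
        \<le> of_nat (card (nbrs :: 'a set)) * (mass w * indicator (ball x (ball_rad k)) w)" .
    qed
    also have "\<dots> = of_nat (card (nbrs :: 'a set)) * ball_mass k"
      unfolding ball_mass_def by (intro nn_integral_cmult borel_measurable_times_ennreal borel_measurable_indicator) auto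
    finally show "(\<integral>\<^sup>+ m. c (k, m) \<partial>count_space (range (idx L k)))
      \<le> ennreal (2 * n * side L k / side L (Suc k) ^ DIM('a)) * (of_nat (card (nbrs :: 'a set)) * ball_mass k)"
      by (simp add: mult_left_mono)
  qed
  finally show ?thesis by (simp add: f_def \<gamma>(2))
qed

text \<open>2^n arises because \<open>side L (Suc k)\<close> is half of \<open>side L k\<close>; n
  comes from shrinking the cube at x, and 2 n \<open>card nbrs\<close> from moving along the
  curve.\<close>

definition pot_const :: real where
  "pot_const = 2 ^ DIM('a) * (n + 2 * n * real (card (nbrs :: 'a set)))"

text \<open>Triangle inequality through the average at x. The factor side^(1-n) is a dyadic form of
  the Riesz kernel of order 1, but paired with balls of radius about side^(1/s).\<close>

lemma john_potential_estimate:
  "ennreal \<bar>u x - cube_avg u (\<gamma> l) (rad (\<gamma> l))\<bar>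
    \<le> (\<integral>\<^sup>+ k. ennreal (pot_const * side L k powr (1 - n)) * ball_mass k \<partial>count_space UNIV)"
proof -
  define N where "N = real (card (nbrs :: 'a set))"
  have "\<bar>u x - cube_avg u (\<gamma> l) (rad (\<gamma> l))\<bar>
      \<le> \<bar>u x - cube_avg u x (rad x)\<bar> + \<bar>cube_avg u x (rad x) - cube_avg u (\<gamma> l) (rad (\<gamma> l))\<bar>"
    by linarith
  then have "ennreal \<bar>u x - cube_avg u (\<gamma> l) (rad (\<gamma> l))\<bar>
      \<le> ennreal \<bar>u x - cube_avg u x (rad x)\<bar> + ennreal \<bar>cube_avg u x (rad x) - cube_avg u (\<gamma> l) (rad (\<gamma> l))\<bar>"
    by (subst ennreal_plus[symmetric]) (auto intro: ennreal_leI simp del: ennreal_plus)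
  also have "\<dots> \<le> (\<integral>\<^sup>+ k. ennreal (n * side L k / side L (Suc k) ^ DIM('a)) * ball_mass k \<partial>count_space UNIV)
     + (\<integral>\<^sup>+ k. ennreal (2 * n * side L k / side L (Suc k) ^ DIM('a)) * (of_nat (card (nbrs :: 'a set)) * ball_mass k) \<partial>count_space UNIV)"
    by (intro add_mono avg_to_center_le avg_along_curve_le)
  also have "\<dots> = (\<integral>\<^sup>+ k. ennreal (n * side L k / side L (Suc k) ^ DIM('a)) * ball_mass k
     + ennreal (2 * n * side L k / side L (Suc k) ^ DIM('a)) * (of_nat (card (nbrs :: 'a set)) * ball_mass k) \<partial>count_space UNIV)"
    by (intro nn_integral_add[symmetric]) auto
  also have "\<dots> = (\<integral>\<^sup>+ k. ennreal (pot_const * side L k powr (1 - n)) * ball_mass k \<partial>count_space UNIV)"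
  proof (intro nn_integral_cong)
    fix k :: nat
    define a where "a = side L k / side L (Suc k) ^ DIM('a)"
    have sp: "side L k > 0" by (rule side_pos[OF L])
    then have a0: "a \<ge> 0" by (simp add: a_def side_Suc)
    have "side L k powr (1 - n) = side L k / side L k ^ DIM('a)"
      using sp by (simp add: powr_diff n powr_realpow)
    then have a: "a = 2 ^ DIM('a) * side L k powr (1 - n)"
      by (simp add: a_def side_Suc power_divide)
    have "ennreal (n * a) * ball_mass k + ennreal (2 * n * a) * (of_nat (card (nbrs :: 'a set)) * ball_mass k)
        = (ennreal (n * a) + ennreal (2 * n * a * N)) * ball_mass k"
      using n_pos a0 by (simp add: N_def ennreal_mult distrib_right ennreal_of_nat_eq_real_of_nat distrib_left mult_ac)
    also have "ennreal (n * a) + ennreal (2 * n * a * N) = ennreal (n * a + 2 * n * a * N)"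
      using n_pos a0 by (subst ennreal_plus) (auto simp: N_def)
    also have "n * a + 2 * n * a * N = pot_const * side L k powr (1 - n)"
      unfolding a pot_const_def N_def by (simp add: algebra_simps)
    finally show "ennreal (n * side L k / side L (Suc k) ^ DIM('a)) * ball_mass k
        + ennreal (2 * n * side L k / side L (Suc k) ^ DIM('a)) * (of_nat (card (nbrs :: 'a set)) * ball_mass k)
      = ennreal (pot_const * side L k powr (1 - n)) * ball_mass k" by (simp add: a_def)
  qed
  finally show ?thesis .
qed

end

section \<open>The weak type inequality on John domains\<close>

lemma sum_geometric_two_sided_le:
  fixes q :: real and j :: int
  assumes "0 < q" "q < 1"
  shows "(\<integral>\<^sup>+ k. ennreal (q ^ nat \<bar>j - int k\<bar>) \<partial>count_space UNIV) \<le> ennreal (2 / (1 - q))"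
proof -
  have half: "(\<integral>\<^sup>+ k. ennreal (q ^ nat \<bar>j - int k\<bar>) \<partial>count_space A) \<le> ennreal (1 / (1 - q))"
    if "inj_on (\<lambda>k. nat \<bar>j - int k\<bar>) A" for A
  proof -
    have "(\<integral>\<^sup>+ k. ennreal (q ^ nat \<bar>j - int k\<bar>) \<partial>count_space A)
        = (\<integral>\<^sup>+ i. ennreal (q ^ i) \<partial>count_space ((\<lambda>k. nat \<bar>j - int k\<bar>) ` A))"
      by (rule nn_integral_bij_count_space) (use that in \<open>simp add: bij_betw_def\<close>)
    also have "\<dots> \<le> (\<integral>\<^sup>+ i. ennreal (q ^ i) \<partial>count_space UNIV)"
      unfolding nn_integral_count_space_by_indicator[where X = "(\<lambda>k. nat \<bar>j - int k\<bar>) ` A"]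
      by (intro nn_integral_mono) (auto split: split_indicator)
    also have "\<dots> = (\<Sum>i. ennreal (q ^ i))" by (rule nn_integral_count_space_nat)
    also have "\<dots> = ennreal (1 / (1 - q))"
      using assms by (subst suminf_ennreal2) (auto simp: suminf_geometric summable_geometric)
    finally show ?thesis .
  qed
  \<comment> \<open>On either side of j the distance |j - k| determines k, so each half is part of
    one geometric series.\<close>
  have "(\<integral>\<^sup>+ k. ennreal (q ^ nat \<bar>j - int k\<bar>) \<partial>count_space ({k. int k \<le> j} \<union> {k. j < int k}))
      \<le> ennreal (1 / (1 - q)) + ennreal (1 / (1 - q))"
    by (rule order_trans[OF nn_integral_count_space_Un_le]) (intro add_mono half; auto simp: inj_on_def)
  also have "{k. int k \<le> j} \<union> {k. j < int k} = UNIV" by auto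
  also have "ennreal (1 / (1 - q)) + ennreal (1 / (1 - q)) = ennreal (2 / (1 - q))"
    using assms by (subst ennreal_plus[symmetric]) auto
  finally show ?thesis .
qed

text \<open>As k grows, M * side^(-a) increases geometrically and \<theta> * side^(\<sigma>-a)
  decreases geometrically. Their minimum peaks where they meet and decays on both sides, so the sum
  is bounded by a multiple of the peak value, the multiple depending only on a and \<sigma>.\<close>

lemma dyadic_min_sum_le:
  fixes a \<sigma> L :: real
  assumes "0 < a" "a < \<sigma>" "L > 0"
  shows "\<exists>C>0. \<forall>M>0. \<forall>\<theta>>0.
    (\<integral>\<^sup>+ k. ennreal (side L k powr (- a) * min M (\<theta> * side L k powr \<sigma>)) \<partial>count_space UNIV)
      \<le> ennreal (C * (M powr (1 - a / \<sigma>) * \<theta> powr (a / \<sigma>)))"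
proof -
  \<comment> \<open>The slower of the two decay rates, so that one ratio q serves both sides of the
    peak.\<close>
  define e where "e = min a (\<sigma> - a)"
  define q :: real where "q = 2 powr (- e)"
  have e: "e > 0" using assms by (simp add: e_def)
  have q: "0 < q" "q < 1" using e powr_less_one[of 2 "-e"] by (auto simp: q_def powr_less_one)
  define C where "C = 2 powr e * (2 / (1 - q))"
  have "C > 0" using q by (simp add: C_def)
  moreover have "(\<integral>\<^sup>+ k. ennreal (side L k powr (- a) * min M (\<theta> * side L k powr \<sigma>)) \<partial>count_space UNIV)
      \<le> ennreal (C * (M powr (1 - a / \<sigma>) * \<theta> powr (a / \<sigma>)))" if M: "M > 0" and \<theta>: "\<theta> > 0" for M \<theta>
  proof -
    \<comment> \<open>\<open>r\<close> is the scale at which the two bounds agree, and \<open>\<nu>\<close> its real-valued generation.\<close>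
    define r where "r = (M / \<theta>) powr (1 / \<sigma>)"
    define B where "B = M * r powr (- a)"
    define \<nu> where "\<nu> = log 2 (L / r)"
    have r: "r > 0" using M \<theta> by (simp add: r_def)
    have r\<sigma>: "\<theta> * r powr \<sigma> = M" using M \<theta> assms by (simp add: r_def powr_powr)
    have B: "B > 0" using M r by (simp add: B_def)
    have B_eq: "B = M powr (1 - a / \<sigma>) * \<theta> powr (a / \<sigma>)"
      using M \<theta> by (simp add: B_def r_def powr_powr powr_divide powr_diff powr_minus field_simps)
    have summand: "side L k powr (- a) * min M (\<theta> * side L k powr \<sigma>) \<le> B * 2 powr (- e * \<bar>\<nu> - real k\<bar>)" for k
    proof -
      define y where "y = \<nu> - real k"
      have sp: "side L k > 0" by (rule side_pos[OF assms(3)])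
      have "2 powr y = side L k / r"
        using r assms(3) by (simp add: y_def \<nu>_def powr_diff powr_log_cancel powr_realpow side_def)
      then have sr: "side L k = r * 2 powr y" using r by simp
      show ?thesis
      proof (cases "y \<ge> 0")
        case True
        have "side L k powr (- a) * min M (\<theta> * side L k powr \<sigma>) \<le> side L k powr (- a) * M"
          by (intro mult_left_mono) auto
        also have "\<dots> = B * 2 powr (- a * y)"
          unfolding sr B_def using r by (simp add: powr_mult powr_powr mult_ac)
        also have "\<dots> \<le> B * 2 powr (- e * \<bar>y\<bar>)"
          using True B by (intro mult_left_mono powr_mono) (auto simp: e_def mult_right_mono)
        finally show ?thesis by (simp add: y_def)
      next
        case False
        have "side L k powr (- a) * min M (\<theta> * side L k powr \<sigma>) \<le> side L k powr (- a) * (\<theta> * side L k powr \<sigma>)"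
          by (intro mult_left_mono) auto
        also have "\<dots> = (\<theta> * r powr \<sigma>) * r powr (- a) * 2 powr ((\<sigma> - a) * y)"
          unfolding sr using r by (simp add: powr_mult powr_powr powr_diff left_diff_distrib powr_minus field_simps)
        also have "\<dots> = B * 2 powr ((\<sigma> - a) * y)" unfolding r\<sigma> B_def by simp
        also have "\<dots> \<le> B * 2 powr (- e * \<bar>y\<bar>)"
          using False B by (intro mult_left_mono powr_mono) (auto simp: e_def mult_right_mono_neg)
        finally show ?thesis by (simp add: y_def)
      qed
    qed
    \<comment> \<open>Rounding the real generation \<nu> down to an integer changes the distance to
      k by at most 1, which costs the factor 2^e.\<close>
    have geo: "2 powr (- e * \<bar>\<nu> - real k\<bar>) \<le> 2 powr e * q ^ nat \<bar>\<lfloor>\<nu>\<rfloor> - int k\<bar>" for k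
    proof -
      have "real_of_int \<bar>\<lfloor>\<nu>\<rfloor> - int k\<bar> \<le> \<bar>\<nu> - real k\<bar> + 1" by linarith
      then have "e * real_of_int \<bar>\<lfloor>\<nu>\<rfloor> - int k\<bar> \<le> e * (\<bar>\<nu> - real k\<bar> + 1)" using e by (intro mult_left_mono) auto
      then have "2 powr (- e * \<bar>\<nu> - real k\<bar>) \<le> 2 powr (e + - e * real_of_int \<bar>\<lfloor>\<nu>\<rfloor> - int k\<bar>)"
        by (intro powr_mono) (auto simp: algebra_simps)
      also have "\<dots> = 2 powr e * (2 powr (- e)) powr real_of_int \<bar>\<lfloor>\<nu>\<rfloor> - int k\<bar>"
        by (simp only: powr_add powr_powr)
      also have "(2 powr (- e)) powr real_of_int \<bar>\<lfloor>\<nu>\<rfloor> - int k\<bar> = q ^ nat \<bar>\<lfloor>\<nu>\<rfloor> - int k\<bar>"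
        using q by (simp add: q_def[symmetric] powr_realpow[symmetric])
      finally show ?thesis .
    qed
    have "(\<integral>\<^sup>+ k. ennreal (side L k powr (- a) * min M (\<theta> * side L k powr \<sigma>)) \<partial>count_space UNIV)
        \<le> (\<integral>\<^sup>+ k. ennreal (B * 2 powr e) * ennreal (q ^ nat \<bar>\<lfloor>\<nu>\<rfloor> - int k\<bar>) \<partial>count_space UNIV)"
    proof (intro nn_integral_mono)
      fix k :: nat
      have "side L k powr (- a) * min M (\<theta> * side L k powr \<sigma>) \<le> B * (2 powr e * q ^ nat \<bar>\<lfloor>\<nu>\<rfloor> - int k\<bar>)"
        using summand[of k] mult_left_mono[OF geo[of k], of B] B by linarith
      then show "ennreal (side L k powr (- a) * min M (\<theta> * side L k powr \<sigma>))
          \<le> ennreal (B * 2 powr e) * ennreal (q ^ nat \<bar>\<lfloor>\<nu>\<rfloor> - int k\<bar>)"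
        using B q by (simp add: ennreal_mult[symmetric] mult.assoc ennreal_leI)
    qed
    also have "\<dots> = ennreal (B * 2 powr e) * (\<integral>\<^sup>+ k. ennreal (q ^ nat \<bar>\<lfloor>\<nu>\<rfloor> - int k\<bar>) \<partial>count_space UNIV)"
      by (simp add: nn_integral_cmult)
    also have "\<dots> \<le> ennreal (B * 2 powr e) * ennreal (2 / (1 - q))"
      by (intro mult_left_mono sum_geometric_two_sided_le q) auto
    also have "\<dots> = ennreal (C * B)"
      using B q by (simp add: ennreal_mult[symmetric] C_def mult_ac)
    finally show ?thesis unfolding B_eq .
  qed
  ultimately show ?thesis by blast
qed

text \<open>The case of a finite Choquet integral \<kappa>. The bound has \<kappa> + \<epsilon>
  because covers are only near-optimal and because \<theta> is found by dividing by a power of the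
  mass bound, which must be positive even for \<kappa> = 0. The constant does not depend on
  \<epsilon>.\<close>

lemma john_weak_type_estimate:
  fixes \<Omega> :: "'a::euclidean_space set" and s \<delta> :: real
  assumes "DIM('a) \<ge> 2" and john: "s_john_domain s \<Omega>"
    and s: "1 \<le> s" "s < real DIM('a) / (real DIM('a) - 1)"
    and \<delta>: "0 < \<delta>" "\<delta> \<le> real DIM('a)"
  shows "\<exists>c>0. \<forall>(u :: 'a \<Rightarrow> real) (Du :: 'a \<Rightarrow> 'a) (t :: real) (\<kappa> :: real) (\<epsilon> :: real).
           (\<forall>x\<in>\<Omega>. GDERIV u x :> Du x) \<longrightarrow> continuous_on \<Omega> Du \<longrightarrow> 0 < t \<longrightarrow> 0 \<le> \<kappa> \<longrightarrow> 0 < \<epsilon> \<longrightarrow>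
           choquet_hcontent \<delta> \<Omega> (\<lambda>x. norm (Du x) powr (\<delta> / real DIM('a))) = ennreal \<kappa> \<longrightarrow>
           (INF b::real. hcontent \<delta> {x \<in> \<Omega>. \<bar>u x - b\<bar> > t})
             \<le> ennreal (c * t powr (- \<delta> / (s * (real DIM('a) - 1))) * (\<kappa> + \<epsilon>) powr (real DIM('a) / (s * (real DIM('a) - 1))))"
proof -
  define n where "n = real DIM('a)"
  define N where "N = real (card (nbrs :: 'a set))"
  \<comment> \<open>The ratio of the exponents n - 1 and n/s in the dyadic sum; it is below 1
    exactly when s < n/(n-1).\<close>
  define \<beta> where "\<beta> = s * (n - 1) / n"
  have n2: "n \<ge> 2" using assms(1) by (simp add: n_def)
  have N: "N > 0" unfolding N_def using card_nbrs_pos[where ?'a='a] by simp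
  have \<sigma>: "n - 1 < n / s" using s n2 unfolding n_def[symmetric] by (simp add: field_simps)
  have \<beta>: "0 < \<beta>" using n2 s(1) by (simp add: \<beta>_def)
  obtain cJ CJ x0 where cJ: "0 < cJ" and x0: "x0 \<in> \<Omega>" and \<Omega>: "open \<Omega>" "bounded \<Omega>"
    and curves: "\<And>x. x \<in> \<Omega> \<Longrightarrow> \<exists>\<gamma> l. arclength_param \<gamma> l \<and> \<gamma> 0 = x \<and> \<gamma> l = x0 \<and> l \<le> CJ \<and>
           (\<forall>t\<in>{0..l}. \<gamma> t \<in> \<Omega> \<and> infdist (\<gamma> t) (frontier \<Omega>) \<ge> cJ * t powr s)"
    using john unfolding s_john_domain_def by blast
  obtain D where D: "\<And>x y. x \<in> \<Omega> \<Longrightarrow> y \<in> \<Omega> \<Longrightarrow> dist x y \<le> D"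
    using \<Omega>(2) bounded_two_points[of \<Omega>] by blast
  define L where "L = \<bar>D\<bar> + 1"
  have L: "L > 0" by (simp add: L_def)
  have diam: "dist x y < L" if "x \<in> \<Omega>" "y \<in> \<Omega>" for x y using D[OF that] by (simp add: L_def)
  obtain C3 where C3: "C3 > 0" and min_sum: "\<And>M \<theta>. M > 0 \<Longrightarrow> \<theta> > 0 \<Longrightarrow>
    (\<integral>\<^sup>+ k. ennreal (side L k powr (- (n - 1)) * min M (\<theta> * side L k powr (n / s))) \<partial>count_space UNIV)
      \<le> ennreal (C3 * (M powr (1 - \<beta>) * \<theta> powr \<beta>))"
    using dyadic_min_sum_le[of "n - 1" "n / s" L] \<sigma> n2 L s(1) by (auto simp: \<beta>_def mult.commute)
  define bc where "bc = (6 * n / cJ) powr (1 / s) + (2 * n + 1) * L powr (1 - 1 / s)"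
  define pc where "pc = 2 ^ DIM('a) * (n + 2 * n * N)"
  have bc: "bc > 0" unfolding bc_def using n2 L by (intro add_nonneg_pos mult_pos_pos) auto
  have pc: "pc > 0" unfolding pc_def using n2 N by (intro mult_pos_pos add_pos_pos) auto
  define C\<mu> where "C\<mu> = 4 * (N * 4 powr \<delta>)"
  have C\<mu>: "C\<mu> > 0" using N by (simp add: C\<mu>_def)
  define Cm where "Cm = 3 * (3 * n) powr \<delta> * (N * 2 ^ (DIM('a) + 1)) powr (\<delta> / n)"
  have Cm: "Cm > 0" using N n2 by (simp add: Cm_def)
  define c where "c = Cm * bc powr \<delta> * (2 * pc * C3) powr (\<delta> / (n * \<beta>)) * C\<mu> powr (1 / \<beta>)"
  have c: "c > 0" using Cm bc pc C3 C\<mu> by (simp add: c_def)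
  have "(INF b::real. hcontent \<delta> {x \<in> \<Omega>. \<bar>u x - b\<bar> > t})
      \<le> ennreal (c * t powr (- \<delta> / (s * (n - 1))) * (\<kappa> + \<epsilon>) powr (n / (s * (n - 1))))"
    if der: "\<And>x. x \<in> \<Omega> \<Longrightarrow> GDERIV u x :> Du x" and Du: "continuous_on \<Omega> Du" and t: "0 < t"
      and \<kappa>: "0 \<le> \<kappa>" and \<epsilon>: "0 < \<epsilon>" and K: "choquet_hcontent \<delta> \<Omega> (\<lambda>x. norm (Du x) powr (\<delta> / n)) = ennreal \<kappa>"
    for u :: "'a \<Rightarrow> real" and Du :: "'a \<Rightarrow> 'a" and t \<kappa> \<epsilon> :: real
  proof -
    define g where "g y = ennreal (norm (Du y)) * indicator \<Omega> y" for y
    define \<mu> where "\<mu> = C\<mu> * (\<kappa> + \<epsilon>)"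
    have \<mu>: "\<mu> > 0" using C\<mu> \<kappa> \<epsilon> by (simp add: \<mu>_def)
    define M where "M = \<mu> powr (n / \<delta>)"
    have M: "M > 0" using \<mu> by (simp add: M_def)
    \<comment> \<open>Solves pc * C3 * M^(1-\<beta>) * \<theta>^\<beta> = t/2, so a point with small
      maximal function has |u x - b0| <= t/2 < t.\<close>
    define \<theta> where "\<theta> = (t / (2 * pc * C3 * M powr (1 - \<beta>))) powr (1 / \<beta>)"
    have \<theta>: "\<theta> > 0" using t pc C3 M by (simp add: \<theta>_def)
    have \<theta>\<beta>: "\<theta> powr \<beta> = t / (2 * pc * C3 * M powr (1 - \<beta>))"
      unfolding \<theta>_def using \<beta> t pc C3 M by (simp add: powr_powr)
    have fin: "choquet_hcontent \<delta> \<Omega> (\<lambda>x. norm (Du x) powr (\<delta> / n)) < \<infinity>" using K by simp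
    obtain b where b: "\<And>k m. 0 \<le> b k m"
      and bF: "\<And>x. x \<in> \<Omega> \<Longrightarrow> norm (Du x) powr (\<delta> / n) > 0 \<Longrightarrow> \<exists>k. norm (Du x) powr (\<delta> / n) \<le> b k (idx L k x)"
      and bsum: "(\<integral>\<^sup>+ c. ennreal (b (fst c) (snd c) * side L (fst c) powr \<delta>) \<partial>count_space (cells L))
        \<le> ennreal (4 * (real (card (nbrs :: 'a set)) * 4 powr \<delta>)) * (choquet_hcontent \<delta> \<Omega> (\<lambda>x. norm (Du x) powr (\<delta> / n)) + ennreal \<epsilon>)"
      using choquet_weights[where \<Omega> = \<Omega> and F = "\<lambda>x. norm (Du x) powr (\<delta> / n)" and \<epsilon> = \<epsilon>, OF L \<delta>(1) diam fin \<epsilon>] by blast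
    have sum: "(\<integral>\<^sup>+ c. ennreal (b (fst c) (snd c) * side L (fst c) powr \<delta>) \<partial>count_space (cells L)) \<le> ennreal \<mu>"
      using bsum C\<mu> \<kappa> \<epsilon> unfolding K N_def[symmetric] C\<mu>_def[symmetric] \<mu>_def
      by (simp add: ennreal_plus[symmetric] ennreal_mult[symmetric] del: ennreal_plus)
    have gb: "\<exists>k. g y \<le> ennreal (b k (idx L k y) powr (n / \<delta>))" for y
    proof (cases "y \<in> \<Omega> \<and> Du y \<noteq> 0")
      case True
      then obtain k where "norm (Du y) powr (\<delta> / n) \<le> b k (idx L k y)" using bF[of y] by auto
      then have "(norm (Du y) powr (\<delta> / n)) powr (n / \<delta>) \<le> b k (idx L k y) powr (n / \<delta>)"
        using n2 \<delta> by (intro powr_mono2) auto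
      moreover have "(norm (Du y) powr (\<delta> / n)) powr (n / \<delta>) = norm (Du y)"
        using n2 \<delta> by (simp add: powr_powr)
      ultimately show ?thesis using True by (auto simp: g_def ennreal_leI)
    qed (auto simp: g_def)
    have g_meas: "g \<in> borel_measurable borel"
      unfolding g_def[abs_def] by (rule gradient_mass_measurable[OF \<Omega>(1) Du])
    have g_total: "(\<integral>\<^sup>+ y. g y \<partial>lborel) \<le> ennreal M"
      unfolding M_def using n2 \<delta>
      by (intro mass_le_total[where b = b and L = L and \<delta> = \<delta>, OF L \<delta>(1) _ _ b \<mu> sum gb]) (auto simp: n_def)
    \<comment> \<open>Absorbs the radius constant: \<theta>' times the n-th power of bc * side^(1/s)
      is \<theta> * side^(n/s).\<close>
    define \<theta>' where "\<theta>' = \<theta> / bc ^ DIM('a)"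
    have \<theta>': "\<theta>' > 0" using \<theta> bc by (simp add: \<theta>'_def)
    \<comment> \<open>The average attached to x0, where all curves end, hence one constant for every
      x.\<close>
    define b0 where "b0 = cube_avg u x0 (infdist x0 (frontier \<Omega>) / (6 * n))"
    define E where "E = {x\<in>\<Omega>. \<exists>R>0. (\<integral>\<^sup>+ y. g y * indicator (ball x R) y \<partial>lborel) > ennreal (\<theta>' * R ^ DIM('a))}"
    have "{x \<in> \<Omega>. \<bar>u x - b0\<bar> > t} \<subseteq> E"
    proof
      fix x assume "x \<in> {x \<in> \<Omega>. \<bar>u x - b0\<bar> > t}"
      then have x: "x \<in> \<Omega>" "\<bar>u x - b0\<bar> > t" by auto
      obtain \<gamma> l where crv: "arclength_param \<gamma> l" "\<gamma> 0 = x" "\<gamma> l = x0"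
        "\<And>t. t \<in> {0..l} \<Longrightarrow> \<gamma> t \<in> \<Omega>" "\<And>t. t \<in> {0..l} \<Longrightarrow> infdist (\<gamma> t) (frontier \<Omega>) \<ge> cJ * t powr s"
        using curves[OF x(1)] by blast
      interpret john_curve \<Omega> n L cJ s l \<gamma> x u Du
        by unfold_locales (use n_def \<Omega> L diam cJ s crv der Du in auto)
      have mass_g: "mass = g" by (simp add: mass_def g_def fun_eq_iff)
      have bc_eq: "ball_const = bc" by (simp add: ball_const_def bc_def)
      have pc_eq: "pot_const = pc" by (simp add: pot_const_def pc_def N_def)
      show "x \<in> E"
      proof (rule ccontr)
        assume "x \<notin> E"
        then have small: "(\<integral>\<^sup>+ y. g y * indicator (ball x R) y \<partial>lborel) \<le> ennreal (\<theta>' * R ^ DIM('a))" if "R > 0" for R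
          using x(1) that by (auto simp: E_def not_less dest: spec[of _ R])
        have bm: "ball_mass k \<le> ennreal (min M (\<theta> * side L k powr (n / s)))" for k
        proof -
          have sp: "side L k > 0" by (rule side_pos[OF L])
          have "ball_mass k \<le> ennreal (\<theta>' * (bc * side L k powr (1 / s)) ^ DIM('a))"
            unfolding ball_mass_def mass_g ball_rad_def bc_eq using bc sp by (intro small) simp
          also have "\<theta>' * (bc * side L k powr (1 / s)) ^ DIM('a) = \<theta> * (side L k powr (1 / s)) powr n"
            unfolding \<theta>'_def n_def using bc sp by (simp add: power_mult_distrib powr_realpow)
          also have "(side L k powr (1 / s)) powr n = side L k powr (n / s)" by (simp add: powr_powr)
          finally have 1: "ball_mass k \<le> ennreal (\<theta> * side L k powr (n / s))" .
          have "ball_mass k \<le> (\<integral>\<^sup>+ y. g y \<partial>lborel)"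
            unfolding ball_mass_def mass_g by (intro nn_integral_mono) (auto split: split_indicator)
          then have 2: "ball_mass k \<le> ennreal M" using g_total by (rule order_trans)
          show ?thesis using 1 2 by (simp add: min_def)
        qed
        have "ennreal \<bar>u x - b0\<bar> \<le> (\<integral>\<^sup>+ k. ennreal (pot_const * side L k powr (1 - n)) * ball_mass k \<partial>count_space UNIV)"
          using john_potential_estimate unfolding crv(3) rad_def b0_def .
        also have "\<dots> \<le> (\<integral>\<^sup>+ k. ennreal pc * ennreal (side L k powr (- (n - 1)) * min M (\<theta> * side L k powr (n / s))) \<partial>count_space UNIV)"
        proof (intro nn_integral_mono)
          fix k :: nat
          have "ennreal (pot_const * side L k powr (1 - n)) * ball_mass k
              \<le> ennreal (pc * side L k powr (1 - n)) * ennreal (min M (\<theta> * side L k powr (n / s)))"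
            unfolding pc_eq by (intro mult_left_mono bm) auto
          also have "\<dots> = ennreal pc * ennreal (side L k powr (- (n - 1)) * min M (\<theta> * side L k powr (n / s)))"
            using pc M \<theta> by (simp add: ennreal_mult[symmetric] mult.assoc)
          finally show "ennreal (pot_const * side L k powr (1 - n)) * ball_mass k
              \<le> ennreal pc * ennreal (side L k powr (- (n - 1)) * min M (\<theta> * side L k powr (n / s)))" .
        qed
        also have "\<dots> = ennreal pc * (\<integral>\<^sup>+ k. ennreal (side L k powr (- (n - 1)) * min M (\<theta> * side L k powr (n / s))) \<partial>count_space UNIV)"
          by (simp add: nn_integral_cmult)
        also have "\<dots> \<le> ennreal pc * ennreal (C3 * (M powr (1 - \<beta>) * \<theta> powr \<beta>))"
          by (intro mult_left_mono min_sum M \<theta>) auto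
        also have "\<dots> = ennreal (pc * (C3 * (M powr (1 - \<beta>) * \<theta> powr \<beta>)))"
          using pc C3 by (subst ennreal_mult) auto
        also have "pc * (C3 * (M powr (1 - \<beta>) * \<theta> powr \<beta>)) = t / 2"
          unfolding \<theta>\<beta> using pc C3 M by simp
        finally show False using x(2) t by (simp add: ennreal_le_iff)
      qed
    qed
    then have "hcontent \<delta> {x \<in> \<Omega>. \<bar>u x - b0\<bar> > t} \<le> hcontent \<delta> E" by (rule hcontent_mono)
    also have "\<dots> \<le> ennreal (Cm * \<mu> * \<theta>' powr (- (\<delta> / n)))"
      unfolding E_def Cm_def N_def n_def
      by (rule hcontent_maximal_le[where b = b and L = L, OF L \<delta> b diam g_meas _ _ \<mu> sum \<theta>'])
        (use gb in \<open>auto simp: g_def n_def\<close>)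
    also have "Cm * \<mu> * \<theta>' powr (- (\<delta> / n)) = c * t powr (- \<delta> / (s * (n - 1))) * (\<kappa> + \<epsilon>) powr (n / (s * (n - 1)))"
    proof -
      \<comment> \<open>The power of \<mu> inside \<theta>^(-\<delta>/n) is 1/\<beta> - 1; the
        factor \<mu> of the weak type bound completes it to 1/\<beta> = n/(s(n-1)).\<close>
      have e1: "\<delta> / (s * (n - 1)) = \<delta> / (n * \<beta>)" "n / (s * (n - 1)) = 1 / \<beta>"
        using n2 s(1) by (auto simp: \<beta>_def)
      have "\<theta>' powr (- (\<delta> / n)) = \<theta> powr (- (\<delta> / n)) * (bc powr n) powr (\<delta> / n)"
        unfolding \<theta>'_def using \<theta> bc by (simp add: powr_divide powr_minus n_def powr_realpow divide_simps)
      also have "(bc powr n) powr (\<delta> / n) = bc powr \<delta>" using n2 by (simp add: powr_powr)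
      also have "\<theta> powr (- (\<delta> / n)) = (t / (2 * pc * C3 * M powr (1 - \<beta>))) powr (- (\<delta> / (n * \<beta>)))"
        unfolding \<theta>_def by (simp add: powr_powr mult.commute)
      also have "\<dots> = t powr (- (\<delta> / (n * \<beta>))) * ((2 * pc * C3) powr (\<delta> / (n * \<beta>)) * (M powr (1 - \<beta>)) powr (\<delta> / (n * \<beta>)))"
        using t pc C3 M by (simp add: powr_divide powr_mult powr_minus field_simps)
      also have "(M powr (1 - \<beta>)) powr (\<delta> / (n * \<beta>)) = \<mu> powr (1 / \<beta> - 1)"
      proof -
        have "n / \<delta> * ((1 - \<beta>) * (\<delta> / (n * \<beta>))) = 1 / \<beta> - 1"
          using n2 \<delta> \<beta> by (simp add: field_simps)
        then show ?thesis by (simp add: M_def powr_powr mult.assoc)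
      qed
      finally have "Cm * \<mu> * \<theta>' powr (- (\<delta> / n))
          = Cm * bc powr \<delta> * (2 * pc * C3) powr (\<delta> / (n * \<beta>)) * t powr (- (\<delta> / (n * \<beta>))) * (\<mu> * \<mu> powr (1 / \<beta> - 1))"
        by (simp add: mult_ac)
      also have "\<mu> * \<mu> powr (1 / \<beta> - 1) = C\<mu> powr (1 / \<beta>) * (\<kappa> + \<epsilon>) powr (1 / \<beta>)"
      proof -
        have "\<mu> * \<mu> powr (1 / \<beta> - 1) = \<mu> powr (1 / \<beta>)" using \<mu> by (simp add: powr_diff)
        then show ?thesis by (simp add: \<mu>_def powr_mult)
      qed
      finally show ?thesis unfolding c_def minus_divide_left[symmetric] e1 by (simp add: mult_ac)
    qed
    finally have "hcontent \<delta> {x \<in> \<Omega>. \<bar>u x - b0\<bar> > t}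
        \<le> ennreal (c * t powr (- \<delta> / (s * (n - 1))) * (\<kappa> + \<epsilon>) powr (n / (s * (n - 1))))" .
    then show ?thesis by (rule INF_lower2[OF UNIV_I])
  qed
  then show ?thesis using c unfolding n_def by (intro exI[of _ c] conjI allI impI) blast+
qed

theorem theorem4p9:
  fixes \<Omega> :: "'a::euclidean_space set" and s \<delta> :: real
  assumes "DIM('a) \<ge> 2"
    and "s_john_domain s \<Omega>"
    and "1 \<le> s" and "s < real DIM('a) / (real DIM('a) - 1)"
    and "0 < \<delta>" and "\<delta> \<le> real DIM('a)"
  shows "\<exists>c>0. \<forall>(u :: 'a \<Rightarrow> real) (Du :: 'a \<Rightarrow> 'a) (t :: real).
           (\<forall>x\<in>\<Omega>. GDERIV u x :> Du x) \<and> continuous_on \<Omega> Du \<and> 0 < t \<longrightarrow>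
           (INF b::real. hcontent \<delta> {x \<in> \<Omega>. \<bar>u x - b\<bar> > t})
             \<le> ennreal (c * t powr (- \<delta> / (s * (real DIM('a) - 1))))
                * enn_powr (choquet_hcontent \<delta> \<Omega> (\<lambda>x. norm (Du x) powr (\<delta> / real DIM('a))))
                    (real DIM('a) / (s * (real DIM('a) - 1)))"
proof -
  define q where "q = real DIM('a) / (s * (real DIM('a) - 1))"
  have q: "q > 0" using assms(1,3) by (auto simp: q_def)
  obtain c where c: "c > 0" and est: "\<And>u Du t \<kappa> \<epsilon>. (\<forall>x\<in>\<Omega>. GDERIV u x :> Du x) \<Longrightarrow> continuous_on \<Omega> Du \<Longrightarrow> 0 < t \<Longrightarrow> 0 \<le> \<kappa> \<Longrightarrow> 0 < \<epsilon> \<Longrightarrow>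
      choquet_hcontent \<delta> \<Omega> (\<lambda>x. norm (Du x) powr (\<delta> / real DIM('a))) = ennreal \<kappa> \<Longrightarrow>
      (INF b::real. hcontent \<delta> {x \<in> \<Omega>. \<bar>u x - b\<bar> > t})
        \<le> ennreal (c * t powr (- \<delta> / (s * (real DIM('a) - 1))) * (\<kappa> + \<epsilon>) powr q)"
    using john_weak_type_estimate[OF assms] unfolding q_def by blast
  show ?thesis
  proof (intro exI[of _ c] conjI c allI impI)
    fix u :: "'a \<Rightarrow> real" and Du :: "'a \<Rightarrow> 'a" and t :: real
    assume asm: "(\<forall>x\<in>\<Omega>. GDERIV u x :> Du x) \<and> continuous_on \<Omega> Du \<and> 0 < t"
    define K where "K = choquet_hcontent \<delta> \<Omega> (\<lambda>x. norm (Du x) powr (\<delta> / real DIM('a)))"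
    define T where "T = c * t powr (- \<delta> / (s * (real DIM('a) - 1)))"
    have T: "T > 0" using c asm by (simp add: T_def)
    have "(INF b::real. hcontent \<delta> {x \<in> \<Omega>. \<bar>u x - b\<bar> > t}) \<le> ennreal T * enn_powr K q"
    proof (cases "K = \<infinity>")
      case True
      then show ?thesis using T by (simp add: enn_powr_def ennreal_mult_top)
    next
      case False
      then obtain \<kappa> where \<kappa>: "K = ennreal \<kappa>" "\<kappa> \<ge> 0" by (cases K) auto
      \<comment> \<open>Let \<epsilon> tend to 0 with c fixed. At \<kappa> = 0 the power is
        continuous from the right because q > 0.\<close>
      have "((\<lambda>\<epsilon>. T * (\<kappa> + \<epsilon>) powr q) \<longlongrightarrow> T * (\<kappa> + 0) powr q) (at_right 0)"
        using \<kappa>(2) q by (intro tendsto_intros tendsto_powr') (auto simp: eventually_at_right_less intro: eventually_mono[OF eventually_at_right_less])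
      then have "((\<lambda>\<epsilon>. ennreal (T * (\<kappa> + \<epsilon>) powr q)) \<longlongrightarrow> ennreal (T * \<kappa> powr q)) (at_right 0)"
        by (intro tendsto_ennrealI) simp
      moreover have "eventually (\<lambda>\<epsilon>. (INF b::real. hcontent \<delta> {x \<in> \<Omega>. \<bar>u x - b\<bar> > t}) \<le> ennreal (T * (\<kappa> + \<epsilon>) powr q)) (at_right 0)"
        using eventually_at_right_less[of "0::real"]
        by eventually_elim (use est[of u Du t \<kappa>] asm \<kappa> in \<open>auto simp: K_def T_def\<close>)
      ultimately have "(INF b::real. hcontent \<delta> {x \<in> \<Omega>. \<bar>u x - b\<bar> > t}) \<le> ennreal (T * \<kappa> powr q)"
        by (rule tendsto_lowerbound) simp
      also have "\<dots> = ennreal T * enn_powr K q"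
        using \<kappa> T by (simp add: enn_powr_def ennreal_mult)
      finally show ?thesis .
    qed
    then show "(INF b::real. hcontent \<delta> {x \<in> \<Omega>. \<bar>u x - b\<bar> > t})
             \<le> ennreal (c * t powr (- \<delta> / (s * (real DIM('a) - 1))))
                * enn_powr (choquet_hcontent \<delta> \<Omega> (\<lambda>x. norm (Du x) powr (\<delta> / real DIM('a))))
                    (real DIM('a) / (s * (real DIM('a) - 1)))"
      by (simp add: T_def K_def q_def)
  qed
qed

end
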